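(* Every aperiodic countable Borel equivalence relation $E$ on an uncountable standard Borel space $X$ admits a Lusin marker scheme of type I and a Lusin marker scheme of type II.
   Context: A complete section for $E$ is a set meeting every $E$-class. A Lusin marker scheme for $E$ is a family $\{A_s\}_{s\in\mathbb N^{<\mathbb N}}$ of Borel subsets of $X$ such that (i) $A_\emptyset=X$; (ii) for each $s$, the sets $A_{sn}$ ($n\in\mathbb N$) are pairwise disjoint and $\bigsqcup_n A_{sn}\subseteq A_s$; (iii) each $A_s$ is a complete section for $E$. It is of type I if moreover $\bigsqcup_nA_{sn}=A_s$ for all $s$ and for each $x\in\mathbb N^\mathbb N$ the set $\bigcap_nA_{x|n}$ is a singleton. It is of type II if, setting $B_n=\bigsqcup\{A_s:s\in\mathbb N^n\}$, the sequence $(B_n)$ is a vanishing sequence of markers, i.e. a decreasing sequence of Borel complete sections with $\bigcap_nB_n=\emptyset$. *)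

theory Defs
  imports "HOL-Analysis.Analysis"
begin

text \<open>Borel spaces are represented by \<^typ>\<open>'a measure\<close>; only the underlying set
  \<^term>\<open>space M\<close> and the sigma-algebra \<^term>\<open>sets M\<close> matter, and the measure itself
  is irrelevant.\<close>

definition standard_borel_space :: "'a measure \<Rightarrow> bool" where
  "standard_borel_space M \<longleftrightarrow>
     (\<exists>T. topspace T = space M \<and> completely_metrizable_space T \<and> separable_space T \<and>
          sets M = sigma_sets (space M) {U. openin T U})"

definition countable_borel_equiv :: "'a measure \<Rightarrow> ('a \<times> 'a) set \<Rightarrow> bool" where
  "countable_borel_equiv M E \<longleftrightarrow>
     equiv (space M) E \<and> E \<in> sets (M \<Otimes>\<^sub>M M) \<and> (\<forall>C \<in> space M // E. countable C)"

definition aperiodic_equiv :: "'a measure \<Rightarrow> ('a \<times> 'a) set \<Rightarrow> bool" where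
  "aperiodic_equiv M E \<longleftrightarrow> (\<forall>C \<in> space M // E. infinite C)"

definition complete_section :: "'a measure \<Rightarrow> ('a \<times> 'a) set \<Rightarrow> 'a set \<Rightarrow> bool" where
  "complete_section M E A \<longleftrightarrow> A \<subseteq> space M \<and> (\<forall>C \<in> space M // E. A \<inter> C \<noteq> {})"

text \<open>Finite sequences of naturals are lists: the extension \<open>sn\<close> of \<open>s\<close> by \<open>n\<close> is
  \<^term>\<open>s @ [n]\<close>, and the restriction of \<open>x\<close> to its first \<open>n\<close> entries is
  \<^term>\<open>map x [0..<n]\<close>.\<close>

definition lusin_marker_scheme ::
  "'a measure \<Rightarrow> ('a \<times> 'a) set \<Rightarrow> (nat list \<Rightarrow> 'a set) \<Rightarrow> bool" where
  "lusin_marker_scheme M E A \<longleftrightarrow>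
     (\<forall>s. A s \<in> sets M) \<and>
     A [] = space M \<and>
     (\<forall>s. disjoint_family (\<lambda>n. A (s @ [n])) \<and> (\<Union>n. A (s @ [n])) \<subseteq> A s) \<and>
     (\<forall>s. complete_section M E (A s))"

definition lusin_marker_scheme_type_I ::
  "'a measure \<Rightarrow> ('a \<times> 'a) set \<Rightarrow> (nat list \<Rightarrow> 'a set) \<Rightarrow> bool" where
  "lusin_marker_scheme_type_I M E A \<longleftrightarrow>
     lusin_marker_scheme M E A \<and>
     (\<forall>s. (\<Union>n. A (s @ [n])) = A s) \<and>
     (\<forall>x :: nat \<Rightarrow> nat. is_singleton (\<Inter>n. A (map x [0..<n])))"

definition vanishing_marker_sequence ::
  "'a measure \<Rightarrow> ('a \<times> 'a) set \<Rightarrow> (nat \<Rightarrow> 'a set) \<Rightarrow> bool" where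
  "vanishing_marker_sequence M E B \<longleftrightarrow>
     decseq B \<and> (\<forall>n. B n \<in> sets M \<and> complete_section M E (B n)) \<and> (\<Inter>n. B n) = {}"

definition lusin_marker_scheme_type_II ::
  "'a measure \<Rightarrow> ('a \<times> 'a) set \<Rightarrow> (nat list \<Rightarrow> 'a set) \<Rightarrow> bool" where
  "lusin_marker_scheme_type_II M E A \<longleftrightarrow>
     lusin_marker_scheme M E A \<and>
     vanishing_marker_sequence M E (\<lambda>n. \<Union>s \<in> {s. length s = n}. A s)"

end

theory Submission
  imports Defs "HOL-Library.Discrete_Functions" "HOL-Library.Nat_Bijection"
begin

text \<open>The theorem reduces to a single Borel function \<open>i: X \<rightarrow> \<nat>\<close> mapping every class onto \<open>\<nat>\<close>. Reading
  \<open>i x\<close> as the code of a finite sequence, the sets of those \<open>x\<close> whose sequence extends \<open>s\<close> form a scheme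
  of type II. For type I, every fibre of \<open>i\<close> is uncountable, hence Borel isomorphic to any prescribed
  uncountable Borel set; matching the fibre with code \<open>s\<close> to a piece inside the cylinder of \<open>s\<close>, where
  the pieces partition Baire space, gives a Borel bijection of \<open>X\<close> with Baire space under which every
  class is dense.

  To find \<open>i\<close>, let \<open>L x\<close> be the length of the agreement of \<open>x\<close>, as a binary sequence, with the least
  accumulation point of its class. It takes infinitely many values on each class, and \<open>i x\<close> is the
  position of \<open>L x\<close> among them. Measurability rests on the Lusin-Novikov theorem: a Borel set with
  countable sections is covered by the graphs of countably many Borel functions. It is proved from
  Lusin separation by a dichotomy whose other alternative is a Cantor set inside one section; the same
  dichotomy over a one-point base yields the perfect set theorem needed for Borel isomorphisms.\<close>

section \<open>Lusin separation\<close>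

text \<open>Projections of closed sets are stable under countable unions and intersections, because
  countably many witnesses can be coded in one sequence, and open sets are countable unions of
  closed ones. Treating \<open>B\<close> together with its complement lets the induction over the
  sigma-algebra pass through complements.\<close>

lemma borel_eq_projection_of_closed:
  fixes B :: "'a::metric_space set"
  assumes "B \<in> sets borel"
  shows "\<exists>F :: ('a \<times> (nat \<Rightarrow> real)) set. closed F \<and> B = fst ` F"
proof -
  define an :: "'a set \<Rightarrow> bool" where
    "an = (\<lambda>B. \<exists>F :: ('a \<times> (nat \<Rightarrow> real)) set. closed F \<and> B = fst ` F)"
  have an_closed: "an C" if "closed C" for C
  proof -
    have "closed (C \<times> (UNIV :: (nat \<Rightarrow> real) set))"
      using that by (intro closed_Times) auto
    moreover have "C = fst ` (C \<times> (UNIV :: (nat \<Rightarrow> real) set))" by auto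
    ultimately show ?thesis unfolding an_def by blast
  qed
  have an_UN: "an (\<Union>n. A n)" if anA: "\<And>n. an (A n)" for A :: "nat \<Rightarrow> 'a set"
  proof -
    have "\<forall>n. \<exists>F :: ('a \<times> (nat \<Rightarrow> real)) set. closed F \<and> A n = fst ` F"
      using anA by (simp add: an_def)
    from choice[OF this] obtain F :: "nat \<Rightarrow> ('a \<times> (nat \<Rightarrow> real)) set"
      where F: "\<And>n. closed (F n)" "\<And>n. A n = fst ` F n"
      by auto
    define s :: "'a \<times> (nat \<Rightarrow> real) \<Rightarrow> 'a \<times> (nat \<Rightarrow> real)"
      where "s = (\<lambda>p. (fst p, \<lambda>k. snd p (Suc k)))"
    have cont: "continuous_on UNIV (\<lambda>p :: 'a \<times> (nat \<Rightarrow> real). snd p k)" for k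
      by (rule continuous_on_product_then_coordinatewise[OF continuous_on_snd[OF continuous_on_id]])
    have "continuous_on UNIV s"
      unfolding s_def
      by (intro continuous_on_Pair continuous_on_coordinatewise_then_product cont continuous_on_fst continuous_on_id)
    then have cs: "closed (s -` F n)" for n
      using F(1) by (simp add: continuous_on_closed_vimage)
    \<comment> \<open>Coordinate 0 names the index of a set containing the point; the shifted
      sequence is the witness for that set. For natural values of coordinate 0, distance at least
      1/2 from \<open>n\<close> just means being different from \<open>n\<close>, and unlike the
      latter it is a closed condition.\<close>
    define G where "G = {p. snd p 0 \<in> \<nat>} \<inter>
       (\<Inter>n. {p. \<bar>snd p 0 - real n\<bar> \<ge> 1/2} \<union> s -` F n)"
    have "closed ((\<lambda>p :: 'a \<times> (nat \<Rightarrow> real). snd p 0) -` \<nat>)"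
      using cont[of 0] closed_Nats by (simp add: continuous_on_closed_vimage)
    moreover have "closed {p :: 'a \<times> (nat \<Rightarrow> real). \<bar>snd p 0 - real n\<bar> \<ge> 1/2}" for n
      by (intro closed_Collect_le continuous_intros cont)
    ultimately have "closed G"
      unfolding G_def vimage_def using cs[unfolded vimage_def] by (intro closed_Int closed_INT closed_Un ballI) auto
    moreover have "(\<Union>n. A n) = fst ` G"
    proof (intro set_eqI iffI)
      fix x assume "x \<in> (\<Union>n. A n)"
      then obtain n w where nw: "(x, w) \<in> F n" using F(2) by auto
      define v where "v = case_nat (real n) w"
      have "\<bar>real n - real m\<bar> \<ge> 1/2" if "m \<noteq> n" for m
        using that by linarith
      then have "(x, v) \<in> G"
        using nw by (force simp: G_def v_def s_def)
      then show "x \<in> fst ` G" by force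
    next
      fix x assume "x \<in> fst ` G"
      then obtain w where w: "(x, w) \<in> G" by auto
      then obtain n where "w 0 = real n" by (auto simp: G_def Nats_def)
      with w have "s (x, w) \<in> F n" by (force simp: G_def)
      then show "x \<in> (\<Union>n. A n)" using F(2) by (force simp: s_def)
    qed
    ultimately show ?thesis unfolding an_def by blast
  qed
  have an_INT: "an (\<Inter>n. A n)" if anA: "\<And>n. an (A n)" for A :: "nat \<Rightarrow> 'a set"
  proof -
    have "\<forall>n. \<exists>F :: ('a \<times> (nat \<Rightarrow> real)) set. closed F \<and> A n = fst ` F"
      using anA by (simp add: an_def)
    from choice[OF this] obtain F :: "nat \<Rightarrow> ('a \<times> (nat \<Rightarrow> real)) set"
      where F: "\<And>n. closed (F n)" "\<And>n. A n = fst ` F n"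
      by auto
    \<comment> \<open>Pairing splits one sequence into countably many, so a single sequence carries
      a witness for every \<open>A n\<close>.\<close>
    define s :: "nat \<Rightarrow> 'a \<times> (nat \<Rightarrow> real) \<Rightarrow> 'a \<times> (nat \<Rightarrow> real)"
      where "s = (\<lambda>n p. (fst p, \<lambda>k. snd p (prod_encode (n, k))))"
    have cont: "continuous_on UNIV (\<lambda>p :: 'a \<times> (nat \<Rightarrow> real). snd p k)" for k
      by (rule continuous_on_product_then_coordinatewise[OF continuous_on_snd[OF continuous_on_id]])
    have "continuous_on UNIV (s n)" for n
      unfolding s_def
      by (intro continuous_on_Pair continuous_on_coordinatewise_then_product cont continuous_on_fst continuous_on_id)
    then have "closed (\<Inter>n. s n -` F n)"
      using F(1) by (simp add: continuous_on_closed_vimage closed_INT)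
    moreover have "(\<Inter>n. A n) = fst ` (\<Inter>n. s n -` F n)"
    proof (intro set_eqI iffI)
      fix x assume "x \<in> (\<Inter>n. A n)"
      then have "\<forall>n. \<exists>w. (x, w) \<in> F n" using F(2) by force
      then obtain w where w: "\<And>n. (x, w n) \<in> F n" by metis
      define v where "v = (\<lambda>j. w (fst (prod_decode j)) (snd (prod_decode j)))"
      have "(x, v) \<in> (\<Inter>n. s n -` F n)"
        using w by (auto simp: s_def v_def)
      then show "x \<in> fst ` (\<Inter>n. s n -` F n)" by force
    next
      fix x assume "x \<in> fst ` (\<Inter>n. s n -` F n)"
      then show "x \<in> (\<Inter>n. A n)" using F(2) by (force simp: s_def)
    qed
    ultimately show ?thesis unfolding an_def by blast
  qed
  have an_open: "an (- C)" if "closed C" for C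
  proof (cases "C = {}")
    case True
    then show ?thesis using an_closed[of UNIV] by simp
  next
    case False
    have "- C = (\<Union>n. {x. infdist x C \<ge> 1 / real (Suc n)})"
    proof (intro set_eqI iffI)
      fix x assume "x \<in> - C"
      then have "infdist x C > 0"
        using in_closed_iff_infdist_zero[OF that False, of x] infdist_nonneg[of x C] by fastforce
      then show "x \<in> (\<Union>n. {x. infdist x C \<ge> 1 / real (Suc n)})"
        using nat_approx_posE[of "infdist x C"] by (auto intro: less_imp_le)
    next
      fix x assume "x \<in> (\<Union>n. {x. infdist x C \<ge> 1 / real (Suc n)})"
      then have "infdist x C > 0"
        by (auto intro: less_le_trans[rotated])
      then show "x \<in> - C"
        using in_closed_iff_infdist_zero[OF that False, of x] by auto
    qed
    moreover have "an {x. infdist x C \<ge> 1 / real (Suc n)}" for n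
      by (intro an_closed closed_Collect_le continuous_intros)
    ultimately show ?thesis using an_UN by simp
  qed
  have "B \<in> sigma_sets UNIV (Collect closed)"
    using assms by (simp add: borel_eq_closed)
  then have "an B \<and> an (- B)"
  proof (induction)
    case (Basic a)
    then show ?case using an_closed an_open by auto
  next
    case Empty
    then show ?case using an_closed by auto
  next
    case (Compl a)
    then show ?case by (simp flip: Compl_eq_Diff_UNIV)
  next
    case (Union a)
    then show ?case using an_UN[of a] an_INT[of "\<lambda>n. - a n"] by auto
  qed
  then show ?thesis unfolding an_def by blast
qed

lemma dense_sequence_exists:
  "\<exists>d :: nat \<Rightarrow> 'a::{metric_space,second_countable_topology}. \<forall>x. \<forall>e>0. \<exists>n. dist (d n) x < e"
proof -
  obtain D :: "'a set" where D: "countable D" "\<And>X. open X \<Longrightarrow> X \<noteq> {} \<Longrightarrow> \<exists>d\<in>D. d \<in> X"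
    using countable_dense_setE by blast
  have "D \<noteq> {}" using D(2)[of UNIV] by auto
  have "\<exists>n. dist (from_nat_into D n) x < e" if e: "e > 0" for x :: 'a and e :: real
  proof -
    obtain y where "y \<in> D" "y \<in> ball x e"
      using D(2)[of "ball x e"] e by (metis centre_in_ball empty_iff open_ball)
    then show ?thesis
      using from_nat_into_surj[OF D(1)] by (metis dist_commute mem_ball)
  qed
  then show ?thesis by blast
qed

section \<open>Borel separation of disjoint continuous images\<close>

definition borel_separated :: "'a::topological_space set \<Rightarrow> 'a set \<Rightarrow> bool" where
  "borel_separated A B \<longleftrightarrow> (\<exists>D \<in> sets borel. A \<subseteq> D \<and> B \<inter> D = {})"

text \<open>If \<open>D i j\<close> separates \<open>A i\<close> from \<open>B j\<close>, then the
  union over \<open>i\<close> of the intersections over \<open>j\<close> separates the unions. The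
  contrapositive is what gets used: inseparable unions contain an inseparable pair of
  pieces.\<close>

lemma borel_separated_UN:
  fixes A B :: "nat \<Rightarrow> 'a::topological_space set"
  assumes "\<And>i j. borel_separated (A i) (B j)"
  shows "borel_separated (\<Union>i. A i) (\<Union>j. B j)"
proof -
  obtain D where D: "\<And>i j. D i j \<in> sets borel" "\<And>i j. A i \<subseteq> D i j" "\<And>i j. B j \<inter> D i j = {}"
    using assms unfolding borel_separated_def by metis
  have "(\<Union>i. \<Inter>j. D i j) \<in> sets borel" using D(1) by auto
  moreover have "(\<Union>i. A i) \<subseteq> (\<Union>i. \<Inter>j. D i j)" using D(2) by auto
  moreover have "(\<Union>j. B j) \<inter> (\<Union>i. \<Inter>j. D i j) = {}" using D(3) by blast
  ultimately show ?thesis unfolding borel_separated_def by blast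
qed

text \<open>An inseparable pair can be cut again and again into smaller inseparable closed pieces,
  which by completeness shrink to points \<open>u\<close> and \<open>v\<close>. Since
  \<open>f u\<close> and \<open>f v\<close> differ, continuity puts the images of late pieces into
  disjoint open sets, and these do separate.\<close>

lemma Lusin_separation_closed:
  fixes f :: "'z::{complete_space,second_countable_topology} \<Rightarrow> 'x::t2_space"
  assumes cont: "continuous_on UNIV f" and cl: "closed A" "closed B" and dj: "f ` A \<inter> f ` B = {}"
  shows "borel_separated (f ` A) (f ` B)"
proof (rule ccontr)
  assume nsep: "\<not> borel_separated (f ` A) (f ` B)"
  obtain d :: "nat \<Rightarrow> 'z" where d: "\<And>x e. e > 0 \<Longrightarrow> \<exists>n. dist (d n) x < e"
    using dense_sequence_exists by blast
  define P where "P = (\<lambda>(n::nat) (S, T). closed S \<and> closed T \<and> S \<subseteq> A \<and> T \<subseteq> B \<and> \<not> borel_separated (f ` S) (f ` T))"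
  define Q where "Q = (\<lambda>n (S, T) (S' :: 'z set, T' :: 'z set).
    S' \<subseteq> S \<and> T' \<subseteq> T \<and> (\<exists>c. S' \<subseteq> cball c (1 / real (Suc n))) \<and> (\<exists>c. T' \<subseteq> cball c (1 / real (Suc n))))"
  have "\<exists>h. \<forall>n. P n (h n) \<and> Q n (h n) (h (Suc n))"
  proof (rule dependent_nat_choice)
    show "\<exists>x. P 0 x" using nsep cl by (auto simp: P_def)
  next
    fix p n assume "P n p"
    then obtain S T where p: "p = (S, T)" "closed S" "closed T" "S \<subseteq> A" "T \<subseteq> B" "\<not> borel_separated (f ` S) (f ` T)"
      by (cases p) (auto simp: P_def)
    define e where "e = 1 / real (Suc n)"
    have "e > 0" by (simp add: e_def)
    then have cov: "(\<Union>i. cball (d i) e) = UNIV"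
      using d by (force intro: less_imp_le)
    have "f ` S = (\<Union>i. f ` (S \<inter> cball (d i) e))" "f ` T = (\<Union>i. f ` (T \<inter> cball (d i) e))"
      using cov by blast+
    then obtain i j where "\<not> borel_separated (f ` (S \<inter> cball (d i) e)) (f ` (T \<inter> cball (d j) e))"
      using p(6) borel_separated_UN[of "\<lambda>i. f ` (S \<inter> cball (d i) e)" "\<lambda>i. f ` (T \<inter> cball (d i) e)"]
      by auto
    then have "P (Suc n) (S \<inter> cball (d i) e, T \<inter> cball (d j) e) \<and> Q n p (S \<inter> cball (d i) e, T \<inter> cball (d j) e)"
      using p by (auto simp: P_def Q_def e_def)
    then show "\<exists>y. P (Suc n) y \<and> Q n p y" by blast
  qed
  then obtain h where h: "\<And>n. P n (h n)" "\<And>n. Q n (h n) (h (Suc n))" by blast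
  define S where "S = fst \<circ> h"
  define T where "T = snd \<circ> h"
  have hST: "h n = (S n, T n)" for n by (simp add: S_def T_def)
  have ST: "closed (S n)" "closed (T n)" "S n \<subseteq> A" "T n \<subseteq> B" "\<not> borel_separated (f ` S n) (f ` T n)" for n
    using h(1)[of n] by (auto simp: P_def hST)
  have sub: "S (Suc n) \<subseteq> S n" "T (Suc n) \<subseteq> T n" for n
    using h(2)[of n] by (auto simp: Q_def hST)
  have ball: "\<exists>c. S (Suc n) \<subseteq> cball c (1 / real (Suc n))" "\<exists>c. T (Suc n) \<subseteq> cball c (1 / real (Suc n))" for n
    using h(2)[of n] by (auto simp: Q_def hST)
  have ne: "S n \<noteq> {}" "T n \<noteq> {}" for n
    using ST(5)[of n] by (auto simp: borel_separated_def)
  have anti: "S n \<subseteq> S m" "T n \<subseteq> T m" if "m \<le> n" for m n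
    using lift_Suc_antimono_le[of S, OF _ that] lift_Suc_antimono_le[of T, OF _ that] sub by auto
  have small: "\<exists>n. \<forall>x\<in>X n. \<forall>y\<in>X n. dist x y < e"
    if "e > 0" and b: "\<And>n. \<exists>c. X (Suc n) \<subseteq> cball c (1 / real (Suc n))" for e and X :: "nat \<Rightarrow> 'z set"
  proof -
    obtain n where n: "1 / real (Suc n) < e / 2" using nat_approx_posE[of "e/2"] \<open>e > 0\<close> by auto
    obtain c where c: "X (Suc n) \<subseteq> cball c (1 / real (Suc n))" using b by blast
    have "dist x y < e" if xy: "x \<in> X (Suc n)" "y \<in> X (Suc n)" for x y
    proof -
      have "dist c x < e / 2" "dist c y < e/2" using c xy n by fastforce+
      then show ?thesis using dist_triangle_half_r by blast
    qed
    then show ?thesis by blast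
  qed
  have smallS: "\<exists>n. \<forall>x\<in>S n. \<forall>y\<in>S n. dist x y < e" and smallT: "\<exists>n. \<forall>x\<in>T n. \<forall>y\<in>T n. dist x y < e"
    if "e > 0" for e using small[OF that, of S] small[OF that, of T] ball by auto
  obtain u where u: "\<And>n. u \<in> S n"
    using decreasing_closed_nest[of S] ST(1) ne(1) anti(1) smallS by metis
  obtain v where v: "\<And>n. v \<in> T n"
    using decreasing_closed_nest[of T] ST(2) ne(2) anti(2) smallT by metis
  have "f u \<noteq> f v" using u[of 0] v[of 0] ST(3,4)[of 0] dj by blast
  then obtain U V where UV: "open U" "open V" "f u \<in> U" "f v \<in> V" "U \<inter> V = {}"
    using hausdorff[of "f u" "f v"] by blast
  have "open (f -` U)" "open (f -` V)" using UV cont by (auto simp: continuous_on_open_vimage)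
  then obtain e1 e2 where e: "e1 > 0" "ball u e1 \<subseteq> f -` U" "e2 > 0" "ball v e2 \<subseteq> f -` V"
    using UV(3,4) unfolding open_contains_ball by (metis vimageI)
  obtain n1 where n1: "\<forall>x\<in>S n1. \<forall>y\<in>S n1. dist x y < e1" using smallS[OF e(1)] by blast
  obtain n2 where n2: "\<forall>x\<in>T n2. \<forall>y\<in>T n2. dist x y < e2" using smallT[OF e(3)] by blast
  define n where "n = max n1 n2"
  have "S n \<subseteq> ball u e1" using n1 u anti(1)[of n1 n] by (auto simp: n_def)
  moreover have "T n \<subseteq> ball v e2" using n2 v anti(2)[of n2 n] by (auto simp: n_def)
  ultimately have "f ` S n \<subseteq> U" "f ` T n \<subseteq> V" using e by auto
  then have "borel_separated (f ` S n) (f ` T n)"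
    unfolding borel_separated_def using UV by (intro bexI[of _ U]) auto
  then show False using ST(5) by blast
qed

text \<open>Borel sets reduce to closed ones by replacing \<open>A\<close> and \<open>B\<close> with
  closed sets of a product that project onto them, and \<open>f\<close> with its composition with
  \<open>fst\<close>.\<close>

theorem Lusin_separation:
  fixes f :: "'z::{complete_space,second_countable_topology} \<Rightarrow> 'x::t2_space"
  assumes cont: "continuous_on UNIV f" and "A \<in> sets borel" "B \<in> sets borel" and dj: "f ` A \<inter> f ` B = {}"
  shows "borel_separated (f ` A) (f ` B)"
proof -
  obtain F G :: "('z \<times> (nat \<Rightarrow> real)) set" where "closed F" "closed G" "A = fst ` F" "B = fst ` G"
    using borel_eq_projection_of_closed assms(2,3) by metis
  moreover have "continuous_on UNIV (\<lambda>p :: 'z \<times> (nat \<Rightarrow> real). f (fst p))"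
    using cont by (rule continuous_on_compose2) (auto intro: continuous_intros)
  ultimately show ?thesis
    using Lusin_separation_closed[of "\<lambda>p. f (fst p)" F G] dj by (simp add: image_image)
qed

text \<open>The set of values of \<open>f\<close> on \<open>A\<close> may fail to be Borel, yet the
  induced function extends to a Borel function on the whole space. For each coordinate and rational
  \<open>q\<close>, the parts of \<open>A\<close> with \<open>h\<close> below \<open>q\<close> and
  not below \<open>q\<close> have disjoint images, so a Borel set \<open>D n q\<close> separates
  them; \<open>g\<close> is rebuilt from these cuts.\<close>

lemma borel_function_through_fibres:
  fixes f :: "'z::{complete_space,second_countable_topology} \<Rightarrow> 'x::t2_space"
    and h :: "'z \<Rightarrow> nat \<Rightarrow> real"
  assumes f: "continuous_on UNIV f" and h: "h \<in> borel_measurable borel" and A: "A \<in> sets borel"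
    and fib: "\<And>u v. u \<in> A \<Longrightarrow> v \<in> A \<Longrightarrow> f u = f v \<Longrightarrow> h u = h v"
  shows "\<exists>g \<in> borel_measurable borel. \<forall>v \<in> A. h v = g (f v)"
proof -
  have [measurable]: "(\<lambda>v. h v n) \<in> borel_measurable borel" for n
    using measurable_product_then_coordinatewise[OF h] .
  have "\<exists>D. D \<in> sets borel \<and> (\<forall>v \<in> A. f v \<in> D \<longleftrightarrow> h v n < of_rat q)" for n q
  proof -
    have "{v. h v n < of_rat q} \<in> sets borel" by measurable
    then have "A \<inter> {v. h v n < of_rat q} \<in> sets borel" "A - {v. h v n < of_rat q} \<in> sets borel"
      using A by auto
    moreover have "f u \<noteq> f v" if "u \<in> A \<inter> {v. h v n < of_rat q}" "v \<in> A - {v. h v n < of_rat q}" for u v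
      using that fib[of u v] by auto
    then have "f ` (A \<inter> {v. h v n < of_rat q}) \<inter> f ` (A - {v. h v n < of_rat q}) = {}"
      by blast
    ultimately have "borel_separated (f ` (A \<inter> {v. h v n < of_rat q})) (f ` (A - {v. h v n < of_rat q}))"
      by (rule Lusin_separation[OF f])
    then obtain D where D: "D \<in> sets borel" "f ` (A \<inter> {v. h v n < of_rat q}) \<subseteq> D"
      "f ` (A - {v. h v n < of_rat q}) \<inter> D = {}"
      unfolding borel_separated_def by (elim bexE conjE)
    have "f v \<in> D \<longleftrightarrow> h v n < of_rat q" if "v \<in> A" for v
    proof (cases "h v n < of_rat q")
      case True
      then have "f v \<in> f ` (A \<inter> {v. h v n < of_rat q})" using that by auto
      then show ?thesis using D(2) True by auto
    next
      case False
      then have "f v \<in> f ` (A - {v. h v n < of_rat q})" using that by auto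
      then show ?thesis using D(3) False by auto
    qed
    then show ?thesis using D(1) by auto
  qed
  then have "\<forall>n q. \<exists>D. D \<in> sets borel \<and> (\<forall>v \<in> A. f v \<in> D \<longleftrightarrow> h v n < of_rat q)" by auto
  then obtain D where D: "\<And>n q. D n q \<in> sets borel \<and> (\<forall>v \<in> A. f v \<in> D n q \<longleftrightarrow> h v n < of_rat q)"
    unfolding choice_iff by auto
  have [measurable]: "D n q \<in> sets borel" for n q using D by auto
  have D_iff: "f v \<in> D n q \<longleftrightarrow> h v n < of_rat q" if "v \<in> A" for v n q
    using that D by auto
  \<comment> \<open>The infimum is taken in the extended reals, because away from the image of
    \<open>A\<close> the rationals involved may be absent or unbounded below. On the image, density
    of the rationals gives back \<open>h\<close>.\<close>
  define g where "g = (\<lambda>x n. real_of_ereal (INF q::rat. if x \<in> D n q then ereal (of_rat q) else \<infinity>))"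
  have "g \<in> borel_measurable borel"
    unfolding g_def
    by (rule measurable_coordinatewise_then_product, intro borel_measurable_real_of_ereal borel_measurable_INF) measurable
  moreover have "h v = g (f v)" if "v \<in> A" for v
  proof
    fix n
    have "(INF q::rat. if f v \<in> D n q then ereal (of_rat q) else \<infinity>) = ereal (h v n)"
    proof (rule INF_eqI)
      fix q :: rat show "ereal (h v n) \<le> (if f v \<in> D n q then ereal (of_rat q) else \<infinity>)"
        by (simp add: D_iff[OF that])
    next
      fix y assume y: "\<And>q. q \<in> UNIV \<Longrightarrow> y \<le> (if f v \<in> D n q then ereal (of_rat q) else \<infinity>)"
      show "y \<le> ereal (h v n)"
      proof (rule ccontr)
        assume "\<not> y \<le> ereal (h v n)"
        then obtain r where r: "ereal (h v n) < ereal r" "ereal r < y"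
          using ereal_dense2 by (meson not_le)
        then obtain q where q: "h v n < of_rat q" "of_rat q < r"
          using of_rat_dense[of "h v n" r] by auto
        have "y \<le> ereal (of_rat q)" using y[of q] q(1) by (simp add: D_iff[OF that])
        also have "\<dots> < ereal r" using q(2) by simp
        finally show False using r(2) by simp
      qed
    qed
    then show "h v n = g (f v) n" by (simp add: g_def)
  qed
  ultimately show ?thesis by blast
qed

section \<open>The Lusin-Novikov theorem\<close>

text \<open>Tuples are sequences whose entries from \<open>k\<close> on are unconstrained, so the
  number of coordinates can grow during a recursion without a change of type.\<close>

definition fibre_product :: "('z \<Rightarrow> 'x) \<Rightarrow> nat \<Rightarrow> (nat \<Rightarrow> 'z set) \<Rightarrow> (nat \<Rightarrow> 'z) set" where
  "fibre_product a k S = {z. \<forall>i<k. z i \<in> S i \<and> a (z i) = a (z 0)}"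

lemma fibre_productD:
  assumes "z \<in> fibre_product a k S" "i < k"
  shows "z i \<in> S i" "a (z i) = a (z 0)"
  using assms unfolding fibre_product_def by blast+

text \<open>A tuple of sets is thin if countably many Borel functions suffice to hit, over every point, some
  entry of every tuple lying in the fibre product. Asking for only one entry to be hit is what
  allows the coordinates to be split one at a time in \<open>not_thin_split\<close>.\<close>

definition thin :: "('z \<Rightarrow> 'x::topological_space) \<Rightarrow> ('z \<Rightarrow> 'y::topological_space) \<Rightarrow> nat \<Rightarrow> (nat \<Rightarrow> 'z set) \<Rightarrow> bool" where
  "thin a b k S \<longleftrightarrow> (\<exists>g :: nat \<Rightarrow> 'x \<Rightarrow> 'y. (\<forall>n. g n \<in> borel_measurable borel) \<and>
     (\<forall>z \<in> fibre_product a k S. \<exists>i<k. \<exists>n. b (z i) = g n (a (z 0))))"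

text \<open>Countably many countable families are merged by enumerating pairs. The merged sequence
  is stated explicitly because \<open>not_thin_split\<close> works with the tuples that it
  misses.\<close>

lemma common_borel_functions:
  fixes a :: "'z \<Rightarrow> 'x::topological_space" and b :: "'z \<Rightarrow> 'y::topological_space"
    and T :: "'i::countable \<Rightarrow> nat \<Rightarrow> 'z set"
  assumes "\<And>j. thin a b k (T j)"
  shows "\<exists>g :: nat \<Rightarrow> 'x \<Rightarrow> 'y. (\<forall>n. g n \<in> borel_measurable borel) \<and>
    (\<forall>j. \<forall>z \<in> fibre_product a k (T j). \<exists>i<k. \<exists>n. b (z i) = g n (a (z 0)))"
proof -
  have "\<forall>j. \<exists>g :: nat \<Rightarrow> 'x \<Rightarrow> 'y. (\<forall>n. g n \<in> borel_measurable borel) \<and>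
      (\<forall>z \<in> fibre_product a k (T j). \<exists>i<k. \<exists>n. b (z i) = g n (a (z 0)))"
    using assms unfolding thin_def by (rule allI)
  then obtain G :: "'i \<Rightarrow> nat \<Rightarrow> 'x \<Rightarrow> 'y" where "\<forall>j. (\<forall>n. G j n \<in> borel_measurable borel) \<and>
      (\<forall>z \<in> fibre_product a k (T j). \<exists>i<k. \<exists>n. b (z i) = G j n (a (z 0)))"
    unfolding choice_iff by (rule exE)
  then have G: "\<And>j n. G j n \<in> borel_measurable borel"
    "\<And>j z. z \<in> fibre_product a k (T j) \<Longrightarrow> \<exists>i<k. \<exists>n. b (z i) = G j n (a (z 0))"
    by auto
  define g where "g = (\<lambda>m. case from_nat m of (j, n) \<Rightarrow> G j n)"
  have g: "g (to_nat (j, n)) = G j n" for j n by (simp add: g_def)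
  have "g n \<in> borel_measurable borel" for n
    using G(1) by (simp add: g_def split: prod.split)
  moreover have "\<exists>i<k. \<exists>n. b (z i) = g n (a (z 0))" if z: "z \<in> fibre_product a k (T j)" for j z
  proof -
    obtain i n where "i < k" "b (z i) = G j n (a (z 0))" using G(2)[OF z] by auto
    then have "b (z i) = g (to_nat (j, n)) (a (z 0))" by (simp add: g)
    then show ?thesis using \<open>i < k\<close> by auto
  qed
  ultimately show ?thesis by (intro exI[of _ g]) auto
qed

lemma thin_countable_cover:
  fixes a :: "'z \<Rightarrow> 'x::topological_space" and b :: "'z \<Rightarrow> 'y::topological_space"
    and T :: "'i::countable \<Rightarrow> nat \<Rightarrow> 'z set"
  assumes "\<And>j. thin a b k (T j)" "fibre_product a k S \<subseteq> (\<Union>j. fibre_product a k (T j))"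
  shows "thin a b k S"
proof -
  obtain g :: "nat \<Rightarrow> 'x \<Rightarrow> 'y" where g: "\<forall>n. g n \<in> borel_measurable borel"
    "\<forall>j. \<forall>z \<in> fibre_product a k (T j). \<exists>i<k. \<exists>n. b (z i) = g n (a (z 0))"
    using common_borel_functions[of a b k T, OF assms(1)] by (elim exE conjE)
  have "\<exists>i<k. \<exists>n. b (z i) = g n (a (z 0))" if "z \<in> fibre_product a k S" for z
    using that assms(2) g(2) by auto
  then show ?thesis using g(1) unfolding thin_def by (intro exI[of _ g]) auto
qed

text \<open>If all splits along basic balls with disjoint \<open>b\<close>-images were thin, one
  sequence \<open>g\<close> would serve all of them. Among the tuples in \<open>W\<close>, those
  missed by \<open>g\<close>, the value \<open>b (z p)\<close> would then depend on
  \<open>a (z 0)\<close> alone, hence be a Borel function \<open>h\<close> of it by separation.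
  Adding \<open>h\<close> to \<open>g\<close> would make \<open>S\<close> thin.\<close>

lemma not_thin_split:
  fixes a :: "'z::{complete_space,second_countable_topology} \<Rightarrow> 'x::{t2_space,second_countable_topology}"
    and b :: "'z \<Rightarrow> nat \<Rightarrow> real"
  assumes a: "continuous_on UNIV a" and b: "continuous_on UNIV b"
    and nt: "\<not> thin a b k S" and cl: "\<And>i. i < k \<Longrightarrow> closed (S i)" and p: "p < k"
  obtains C C' where "closed C" "closed C'" "b ` C \<inter> b ` C' = {}"
    "\<not> thin a b (Suc k) (S(p := S p \<inter> C, k := S p \<inter> C'))"
proof (rule ccontr)
  assume no: "\<not> thesis"
  obtain d :: "nat \<Rightarrow> 'z" where d: "\<And>x e. e > 0 \<Longrightarrow> \<exists>n. dist (d n) x < e"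
    using dense_sequence_exists by blast
  define C where "C = (\<lambda>(i, m). cball (d i) (1 / real (Suc m)))"
  have near: "\<exists>j. v \<in> C j \<and> C j \<subseteq> V" if V: "open V" "v \<in> V" for v V
  proof -
    obtain e where e: "e > 0" "ball v e \<subseteq> V" using V open_contains_ball by blast
    obtain m where m: "1 / real (Suc m) < e / 2" using nat_approx_posE[of "e/2"] e(1) by auto
    obtain i where i: "dist (d i) v < 1 / real (Suc m)" using d[of "1 / real (Suc m)"] by auto
    have "C (i, m) \<subseteq> ball v e"
    proof
      fix x assume "x \<in> C (i, m)"
      then have "dist (d i) x < e / 2" using m by (auto simp: C_def)
      moreover have "dist (d i) v < e / 2" using i m by simp
      ultimately show "x \<in> ball v e" using dist_triangle_half_r by auto
    qed
    moreover have "v \<in> C (i, m)" using i by (simp add: C_def)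
    ultimately show ?thesis using e(2) by blast
  qed
  define J where "J = {j. b ` C (fst j) \<inter> b ` C (snd j) = {}}"
  \<comment> \<open>Pairs of balls outside \<open>J\<close> get empty sets, so that the family is
    indexed by a whole countable type.\<close>
  define T where "T = (\<lambda>j. if j \<in> J then S(p := S p \<inter> C (fst j), k := S p \<inter> C (snd j)) else (\<lambda>_. {}))"
  have clC: "closed (C j)" for j by (auto simp: C_def split: prod.split)
  have "thin a b (Suc k) (T j)" for j
  proof (cases "j \<in> J")
    case True
    then have "b ` C (fst j) \<inter> b ` C (snd j) = {}" by (simp add: J_def)
    then show ?thesis
      using no that[of "C (fst j)" "C (snd j)"] clC True by (auto simp: T_def)
  next
    case False
    then have "fibre_product a (Suc k) (T j) = {}" by (auto simp: T_def fibre_product_def)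
    moreover have "(\<lambda>x :: 'x. b (d 0)) \<in> borel_measurable borel" by simp
    ultimately show ?thesis unfolding thin_def by (intro exI[of _ "\<lambda>n x. b (d 0)"]) simp
  qed
  from common_borel_functions[of a b "Suc k" T, OF this]
  obtain g :: "nat \<Rightarrow> 'x \<Rightarrow> nat \<Rightarrow> real" where g': "\<forall>n. g n \<in> borel_measurable borel"
    "\<forall>j. \<forall>z \<in> fibre_product a (Suc k) (T j). \<exists>i<Suc k. \<exists>n. b (z i) = g n (a (z 0))"
    by (elim exE conjE)
  then have g: "\<And>n. g n \<in> borel_measurable borel"
    "\<And>j z. z \<in> fibre_product a (Suc k) (T j) \<Longrightarrow> \<exists>i<Suc k. \<exists>n. b (z i) = g n (a (z 0))"
    by auto
  define W where "W = {z \<in> fibre_product a k S. \<forall>i<k. \<forall>n. b (z i) \<noteq> g n (a (z 0))}"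
  have ma[measurable]: "a \<in> borel_measurable borel" and mb[measurable]: "b \<in> borel_measurable borel"
    using a b by (auto intro: borel_measurable_continuous_onI)
  note g(1)[measurable]
  have W_eq: "W = (\<Inter>i\<in>{..<k}. ((\<lambda>z. z i) -` S i \<inter> {z. a (z i) = a (z 0)}) \<inter> (\<Inter>n. - {z. b (z i) = g n (a (z 0))}))"
    by (auto simp: W_def fibre_product_def)
  have "((\<lambda>z. z i) -` S i \<inter> {z. a (z i) = a (z 0)}) \<inter> (\<Inter>n. - {z. b (z i) = g n (a (z 0))}) \<in> sets borel"
    if "i < k" for i
  proof -
    have [measurable]: "S i \<in> sets borel" using cl that by auto
    have "(\<lambda>z :: nat \<Rightarrow> 'z. z i) -` S i \<inter> space borel \<in> sets borel"
      "{z \<in> space borel. a (z i) = a ((z :: nat \<Rightarrow> 'z) 0)} \<in> sets borel" by measurable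
    then have s1: "(\<lambda>z :: nat \<Rightarrow> 'z. z i) -` S i \<in> sets borel" "{z. a (z i) = a ((z :: nat \<Rightarrow> 'z) 0)} \<in> sets borel"
      by simp_all
    have "{z \<in> space borel. b (z i) = g n (a ((z :: nat \<Rightarrow> 'z) 0))} \<in> sets borel" for n by measurable
    then have "(\<Inter>n. - {z. b (z i) = g n (a ((z :: nat \<Rightarrow> 'z) 0))}) \<in> sets borel"
      by (intro sets.countable_INT'' borel_comp) simp_all
    then show ?thesis by (intro sets.Int s1)
  qed
  then have "W \<in> sets borel"
    unfolding W_eq using p by (intro sets.finite_INT) auto
  moreover have "continuous_on UNIV (\<lambda>z :: nat \<Rightarrow> 'z. a (z 0))"
    by (rule continuous_on_compose2[OF a]) auto
  moreover have "(\<lambda>z :: nat \<Rightarrow> 'z. b (z p)) \<in> borel_measurable borel" by measurable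
  moreover have "b (z p) = b (z' p)" if z: "z \<in> W" and z': "z' \<in> W" and eq: "a (z 0) = a (z' 0)" for z z'
  proof (rule ccontr)
    assume "b (z p) \<noteq> b (z' p)"
    from hausdorff[OF this] obtain U V where UV: "open U" "open V" "b (z p) \<in> U" "b (z' p) \<in> V" "U \<inter> V = {}"
      by (elim exE conjE)
    then have "open (b -` U)" "open (b -` V)" using b by (auto simp: continuous_on_open_vimage)
    then obtain j j' where j: "z p \<in> C j" "C j \<subseteq> b -` U" "z' p \<in> C j'" "C j' \<subseteq> b -` V"
      using near[of "b -` U" "z p"] near[of "b -` V" "z' p"] UV(3,4) by auto
    then have "b ` C j \<inter> b ` C j' \<subseteq> U \<inter> V"
      by (intro Int_mono) (simp_all add: image_subset_iff_subset_vimage)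
    then have "b ` C j \<inter> b ` C j' = {}" using UV(5) by simp
    then have J: "(j, j') \<in> J" by (simp add: J_def)
    have W: "z \<in> fibre_product a k S" "z' \<in> fibre_product a k S"
      using z z' unfolding W_def by blast+
    \<comment> \<open>Two tuples over the same point are glued: \<open>z' p\<close> becomes the new
      coordinate of \<open>z\<close>. A hit of \<open>g\<close> at coordinate \<open>k\<close> is a
      hit of \<open>z'\<close> at \<open>p\<close>, and a hit at an earlier coordinate is a hit of
      \<open>z\<close>; membership in \<open>W\<close> rules out both.\<close>
    have "(z(k := z' p)) i \<in> T (j, j') i \<and> a ((z(k := z' p)) i) = a ((z(k := z' p)) 0)" if "i < Suc k" for i
    proof (cases "i = k")
      case True
      then show ?thesis
        using J j(3) p eq fibre_productD[OF W(2) p] by (simp add: T_def)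
    next
      case False
      then show ?thesis
        using J j(1) p that fibre_productD[OF W(1), of i] by (auto simp: T_def)
    qed
    then have "z(k := z' p) \<in> fibre_product a (Suc k) (T (j, j'))"
      unfolding fibre_product_def by blast
    from g(2)[OF this] obtain i n where "i < Suc k" "b ((z(k := z' p)) i) = g n (a ((z(k := z' p)) 0))"
      by (elim exE conjE)
    then have i: "i < Suc k" "b ((z(k := z' p)) i) = g n (a (z 0))" using p by simp_all
    show False
    proof (cases "i = k")
      case True
      then have "b (z' p) = g n (a (z' 0))" using i eq by simp
      then show False using z' p unfolding W_def by blast
    next
      case False
      then have "i < k" "b (z i) = g n (a (z 0))" using i by simp_all
      then show False using z unfolding W_def by blast
    qed
  qed
  ultimately have "\<exists>h \<in> borel_measurable borel. \<forall>z \<in> W. b (z p) = h (a (z 0))"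
    by (intro borel_function_through_fibres)
  then obtain h where h: "h \<in> borel_measurable borel" "\<forall>z \<in> W. b (z p) = h (a (z 0))"
    by (elim bexE)
  have "thin a b k S"
    unfolding thin_def
  proof (intro exI[of _ "case_nat h g"] conjI allI ballI)
    show "case_nat h g n \<in> borel_measurable borel" for n
      using h(1) g(1) by (simp split: nat.split)
    fix z assume z: "z \<in> fibre_product a k S"
    show "\<exists>i<k. \<exists>n. b (z i) = case_nat h g n (a (z 0))"
    proof (cases "z \<in> W")
      case True
      then have "b (z p) = case_nat h g 0 (a (z 0))" using h(2) by simp
      then show ?thesis using p by blast
    next
      case False
      then obtain i n where "i < k" "b (z i) = g n (a (z 0))" using z unfolding W_def by blast
      then have "b (z i) = case_nat h g (Suc n) (a (z 0))" by simp
      then show ?thesis using \<open>i < k\<close> by blast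
    qed
  qed
  then show False using nt by simp
qed

text \<open>Balls of radius \<open>e\<close> around a dense sequence cover the space, and the
  choices of one ball per coordinate are coded by lists of naturals, of which there are countably
  many. If every choice gave a thin tuple, so would the union.\<close>

lemma not_thin_shrink:
  fixes a :: "'z::{complete_space,second_countable_topology} \<Rightarrow> 'x::t2_space"
  assumes nt: "\<not> thin a b k S" and e: "e > 0"
  obtains c where "\<not> thin a b k (\<lambda>i. S i \<inter> cball (c i) e)"
proof (rule ccontr)
  assume no: "\<not> thesis"
  obtain d :: "nat \<Rightarrow> 'z" where d: "\<And>x e. e > 0 \<Longrightarrow> \<exists>n. dist (d n) x < e"
    using dense_sequence_exists by blast
  define T where "T = (\<lambda>(l :: nat list) i. S i \<inter> cball (d (l ! i)) e)"
  have "thin a b k (T l)" for l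
    using no that[of "\<lambda>i. d (l ! i)"] by (auto simp: T_def)
  moreover have "fibre_product a k S \<subseteq> (\<Union>l. fibre_product a k (T l))"
  proof
    fix z assume z: "z \<in> fibre_product a k S"
    have "\<forall>i. \<exists>n. dist (d n) (z i) < e" using d[OF e] by auto
    from choice[OF this] obtain m where m: "\<And>i. dist (d (m i)) (z i) < e" by auto
    then have "z i \<in> T (map m [0..<k]) i \<and> a (z i) = a (z 0)" if "i < k" for i
      using fibre_productD[OF z that] that by (simp add: T_def less_imp_le)
    then have "z \<in> fibre_product a k (T (map m [0..<k]))"
      unfolding fibre_product_def by blast
    then show "z \<in> (\<Union>l. fibre_product a k (T l))" by blast
  qed
  ultimately show False using thin_countable_cover[of a b k T S] nt by blast
qed

text \<open>One stage of the Cantor scheme: coordinate \<open>p\<close> is split into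
  \<open>p\<close> and \<open>k\<close>, then every coordinate is shrunk. Shrinking last preserves
  the disjointness of the two images.\<close>

lemma not_thin_step:
  fixes a :: "'z::{complete_space,second_countable_topology} \<Rightarrow> 'x::{t2_space,second_countable_topology}"
    and b :: "'z \<Rightarrow> nat \<Rightarrow> real"
  assumes a: "continuous_on UNIV a" and b: "continuous_on UNIV b"
    and nt: "\<not> thin a b k S" and cl: "\<And>i. i < k \<Longrightarrow> closed (S i)" and p: "p < k" and e: "e > 0"
  shows "\<exists>S'. \<not> thin a b (Suc k) S' \<and> (\<forall>i<Suc k. closed (S' i)) \<and> (\<forall>i<k. S' i \<subseteq> S i) \<and> S' k \<subseteq> S p \<and>
    b ` S' p \<inter> b ` S' k = {} \<and> (\<forall>i<Suc k. \<exists>c. S' i \<subseteq> cball c e)"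
proof -
  obtain C C' where C: "closed C" "closed C'" "b ` C \<inter> b ` C' = {}"
    "\<not> thin a b (Suc k) (S(p := S p \<inter> C, k := S p \<inter> C'))"
    using not_thin_split[OF a b nt cl p] by blast
  obtain c where c: "\<not> thin a b (Suc k) (\<lambda>i. (S(p := S p \<inter> C, k := S p \<inter> C')) i \<inter> cball (c i) e)"
    using not_thin_shrink[OF C(4) e] by blast
  define S' where "S' = (\<lambda>i. (S(p := S p \<inter> C, k := S p \<inter> C')) i \<inter> cball (c i) e)"
  have "closed (S' i)" if "i < Suc k" for i
    using that cl[of i] cl[OF p] C(1,2) by (auto simp: S'_def less_Suc_eq)
  moreover have "S' i \<subseteq> S i" if "i < k" for i using that p by (auto simp: S'_def)
  moreover have "S' k \<subseteq> S p" by (auto simp: S'_def)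
  moreover have "b ` S' p \<inter> b ` S' k = {}"
  proof -
    have "S' p \<subseteq> C" "S' k \<subseteq> C'" using p by (auto simp: S'_def)
    then have "b ` S' p \<inter> b ` S' k \<subseteq> b ` C \<inter> b ` C'" by (intro Int_mono image_mono)
    then show ?thesis using C(3) by simp
  qed
  moreover have "\<exists>c. S' i \<subseteq> cball c e" for i by (rule exI[of _ "c i"]) (auto simp: S'_def)
  moreover have "\<not> thin a b (Suc k) S'" using c by (simp add: S'_def)
  ultimately show ?thesis by (intro exI[of _ S']) auto
qed

section \<open>A Cantor set inside one section\<close>

lemma binary_sum_less_two_power:
  "(\<Sum>j<n. of_bool (\<alpha> j) * 2 ^ j) < (2::nat) ^ n"
  by (induction n) (auto simp: of_bool_def)

text \<open>Without a countable cover, the one-coordinate tuple \<open>F\<close> is not thin, and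
  repeated splitting yields a Cantor scheme of closed sets. Nonempty fibre products at every stage
  force all limit points over one \<open>x\<close>, and disjoint \<open>b\<close>-images give
  injectivity. The last clause of the conclusion is continuity of \<theta>, spelled out with initial
  segments.\<close>

theorem Lusin_Novikov_dichotomy:
  fixes a :: "'z::{complete_space,second_countable_topology} \<Rightarrow> 'x::{t2_space,second_countable_topology}"
    and b :: "'z \<Rightarrow> nat \<Rightarrow> real"
  assumes a: "continuous_on UNIV a" and b: "continuous_on UNIV b" and F: "closed F"
    and no_cover: "\<not> (\<exists>g :: nat \<Rightarrow> 'x \<Rightarrow> nat \<Rightarrow> real. (\<forall>n. g n \<in> borel_measurable borel) \<and> (\<forall>z \<in> F. \<exists>n. b z = g n (a z)))"
  shows "\<exists>x. \<exists>\<theta> :: (nat \<Rightarrow> bool) \<Rightarrow> 'z. range \<theta> \<subseteq> F \<and> (\<forall>\<alpha>. a (\<theta> \<alpha>) = x) \<and> inj (b \<circ> \<theta>) \<and>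
    (\<forall>U \<alpha>. open U \<longrightarrow> \<theta> \<alpha> \<in> U \<longrightarrow> (\<exists>n. \<forall>\<beta>. (\<forall>i<n. \<beta> i = \<alpha> i) \<longrightarrow> \<theta> \<beta> \<in> U))"
proof -
  \<comment> \<open>Coordinate \<open>k\<close> is split off from coordinate \<open>p k\<close>, obtained by deleting the leading binary digit of
    \<open>k\<close>; so at stage \<open>2 ^ n\<close> the coordinates are the nodes of level \<open>n\<close> of the binary tree.\<close>
  define p where "p = (\<lambda>k. k - 2 ^ floor_log k :: nat)"
  have p_less: "p k < k" if "k > 0" for k using that by (simp add: p_def)
  have p_eq: "p (2 ^ n + c) = c" if "c < 2 ^ n" for n c
  proof -
    have "floor_log (2 ^ n + c) = n"
      by (rule floor_log_eqI) (use that in auto)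
    then show ?thesis by (simp add: p_def)
  qed
  have nt0: "\<not> thin a b (Suc 0) (\<lambda>_. F)"
  proof
    assume "thin a b (Suc 0) (\<lambda>_. F)"
    then obtain g :: "nat \<Rightarrow> 'x \<Rightarrow> nat \<Rightarrow> real" where g: "\<forall>n. g n \<in> borel_measurable borel"
      "\<forall>z \<in> fibre_product a (Suc 0) (\<lambda>_. F). \<exists>i<Suc 0. \<exists>n. b (z i) = g n (a (z 0))"
      unfolding thin_def by (elim exE conjE)
    have "\<exists>n. b z = g n (a z)" if "z \<in> F" for z
      using g(2)[rule_format, of "\<lambda>_. z"] that by (auto simp: fibre_product_def)
    then show False using g(1) no_cover by blast
  qed
  \<comment> \<open>The clause for \<open>n = 0\<close> records the starting tuple through the
    dependent choice; it is needed to see that the limit points lie in \<open>F\<close>.\<close>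
  define P where "P = (\<lambda>n S. \<not> thin a b (Suc n) S \<and> (\<forall>i<Suc n. closed (S i)) \<and> (n = 0 \<longrightarrow> S = (\<lambda>_. F)))"
  define Q where "Q = (\<lambda>n S S'. (\<forall>i<Suc n. S' i \<subseteq> S i) \<and> S' (Suc n) \<subseteq> S (p (Suc n)) \<and>
    b ` S' (p (Suc n)) \<inter> b ` S' (Suc n) = {} \<and> (\<forall>i<Suc (Suc n). \<exists>c. S' i \<subseteq> cball c (1 / real (Suc n))))"
  have "\<exists>S. \<forall>n. P n (S n) \<and> Q n (S n) (S (Suc n))"
  proof (rule dependent_nat_choice)
    show "\<exists>S. P 0 S" using nt0 F by (intro exI[of _ "\<lambda>_. F"]) (auto simp: P_def)
  next
    fix S n assume S: "P n S"
    have "\<exists>S'. \<not> thin a b (Suc (Suc n)) S' \<and> (\<forall>i<Suc (Suc n). closed (S' i)) \<and> (\<forall>i<Suc n. S' i \<subseteq> S i) \<and>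
      S' (Suc n) \<subseteq> S (p (Suc n)) \<and> b ` S' (p (Suc n)) \<inter> b ` S' (Suc n) = {} \<and>
      (\<forall>i<Suc (Suc n). \<exists>c. S' i \<subseteq> cball c (1 / real (Suc n)))"
      by (rule not_thin_step[OF a b]) (use S p_less[of "Suc n"] in \<open>auto simp: P_def\<close>)
    then show "\<exists>S'. P (Suc n) S' \<and> Q n S S'"
      by (auto simp: P_def Q_def)
  qed
  then obtain S0 where S0: "\<And>n. P n (S0 n)" "\<And>n. Q n (S0 n) (S0 (Suc n))" by blast
  \<comment> \<open>Reindexed so that, for positive \<open>k\<close>, stage \<open>k\<close> has
    exactly \<open>k\<close> coordinates.\<close>
  define T where "T = (\<lambda>k. S0 (k - 1))"
  have T_nt: "\<not> thin a b k (T k)" and T_cl: "\<And>i. i < k \<Longrightarrow> closed (T k i)" if "k > 0" for k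
    using S0(1)[of "k - 1"] that by (auto simp: P_def T_def)
  have T_sub: "T (Suc k) i \<subseteq> T k i" if "i < k" for k i
    using S0(2)[of "k - 1"] that by (auto simp: Q_def T_def)
  have T_new: "T (Suc k) k \<subseteq> T k (p k)" "b ` T (Suc k) (p k) \<inter> b ` T (Suc k) k = {}" if "k > 0" for k
    using S0(2)[of "k - 1"] that by (auto simp: Q_def T_def)
  have T_ball: "\<exists>c. T (Suc k) i \<subseteq> cball c (1 / real k)" if "k > 0" "i < Suc k" for k i
    using S0(2)[of "k - 1"] that by (auto simp: Q_def T_def)
  have T_anti: "T l i \<subseteq> T k i" if "k \<le> l" "i < k" for k l i
    using that(1)
  proof (induction rule: dec_induct)
    case (step m)
    then show ?case using T_sub[of i m] that(2) by auto
  qed simp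
  have T_fib: "\<exists>z. (\<forall>i<k. z i \<in> T k i \<and> a (z i) = a (z 0))" if "k > 0" for k
  proof (rule ccontr)
    assume "\<not> ?thesis"
    then have "fibre_product a k (T k) = {}" by (simp add: fibre_product_def)
    moreover have "(\<lambda>x :: 'x. (\<lambda>_. 0) :: nat \<Rightarrow> real) \<in> borel_measurable borel" by simp
    ultimately have "thin a b k (T k)" unfolding thin_def by (intro exI[of _ "\<lambda>n x _. 0"]) simp
    then show False using T_nt[OF that] by simp
  qed
  \<comment> \<open>The first \<open>n\<close> bits, read with bit \<open>j\<close> of weight
    \<open>2 ^ j\<close>. A new true bit adds a leading digit, so it moves to the coordinate that
    was split off from the present one, while a false bit stays put.\<close>
  define c where "c = (\<lambda>(\<alpha> :: nat \<Rightarrow> bool) n. \<Sum>j<n. of_bool (\<alpha> j) * 2 ^ j :: nat)"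
  have c_less: "c \<alpha> n < 2 ^ n" for \<alpha> n unfolding c_def by (rule binary_sum_less_two_power)
  have c_Suc: "c \<alpha> (Suc n) = (if \<alpha> n then 2 ^ n + c \<alpha> n else c \<alpha> n)" for \<alpha> n
    unfolding c_def sum.lessThan_Suc by (cases "\<alpha> n") simp_all
  have c_cong: "c \<alpha> n = c \<beta> n" if "\<And>i. i < n \<Longrightarrow> \<alpha> i = \<beta> i" for \<alpha> \<beta> n
    unfolding c_def using that by (intro sum.cong) auto
  define R where "R = (\<lambda>\<alpha> n. T (2 ^ n) (c \<alpha> n))"
  have R_cl: "closed (R \<alpha> n)" for \<alpha> n unfolding R_def using T_cl c_less by simp
  have R_ne: "R \<alpha> n \<noteq> {}" for \<alpha> n unfolding R_def using T_fib[of "2 ^ n"] c_less by fastforce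
  have R_Suc: "R \<alpha> (Suc n) \<subseteq> R \<alpha> n" for \<alpha> n
  proof (cases "\<alpha> n")
    case True
    define k where "k = 2 ^ n + c \<alpha> n"
    have "R \<alpha> (Suc n) = T (2 ^ Suc n) k" using True by (simp add: R_def c_Suc k_def)
    also have "\<dots> \<subseteq> T (Suc k) k" using c_less[of \<alpha> n] by (intro T_anti) (auto simp: k_def)
    also have "\<dots> \<subseteq> T k (c \<alpha> n)" using T_new(1)[of k] p_eq[OF c_less[of \<alpha> n]] by (simp add: k_def)
    also have "\<dots> \<subseteq> R \<alpha> n" unfolding R_def using c_less by (intro T_anti) (auto simp: k_def)
    finally show ?thesis .
  next
    case False
    then show ?thesis unfolding R_def c_Suc using c_less[of \<alpha> n] by (simp add: T_anti)
  qed
  have R_anti: "R \<alpha> n \<subseteq> R \<alpha> m" if "m \<le> n" for \<alpha> m n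
    using lift_Suc_antimono_le[of "R \<alpha>", OF R_Suc that] .
  have R_small: "\<exists>n. \<forall>u \<in> R \<alpha> n. \<forall>v \<in> R \<alpha> n. dist u v < e" if e: "e > 0" for \<alpha> and e :: real
  proof -
    obtain m where m: "1 / real (Suc m) < e / 2" using nat_approx_posE[of "e/2"] e by auto
    \<comment> \<open>Chosen so that \<open>Suc k\<close> is a power of two, hence a stage at which
      \<open>R\<close> is read off, while the radius \<open>1 / k\<close> is at most
      \<open>1 / Suc m\<close>.\<close>
    define k where "k = (2 ^ (m + 2) - 1 :: nat)"
    have "m + 2 < (2::nat) ^ (m + 2)" by (rule less_exp)
    then have k: "Suc m \<le> k" "2 ^ (m + 2) = Suc k" by (auto simp: k_def)
    obtain q where "T (Suc k) (c \<alpha> (m + 2)) \<subseteq> cball q (1 / real k)"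
      using T_ball[of k "c \<alpha> (m + 2)"] k c_less[of \<alpha> "m + 2"] by auto
    then have q: "R \<alpha> (m + 2) \<subseteq> cball q (1 / real k)" unfolding R_def k(2) .
    have "1 / real k \<le> 1 / real (Suc m)" using k(1) by (simp add: frac_le)
    then have "1 / real k < e / 2" using m by simp
    then have "dist q u < e / 2" if "u \<in> R \<alpha> (m + 2)" for u using that q by fastforce
    then have "\<forall>u \<in> R \<alpha> (m + 2). \<forall>v \<in> R \<alpha> (m + 2). dist u v < e"
      using dist_triangle_half_r by blast
    then show ?thesis by blast
  qed
  have "\<exists>z. \<forall>n. z \<in> R \<alpha> n" for \<alpha>
    using decreasing_closed_nest[of "R \<alpha>"] R_cl R_ne R_anti R_small by metis
  then have "\<forall>\<alpha>. \<exists>z. \<forall>n. z \<in> R \<alpha> n" by (rule allI)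
  from choice[OF this] obtain \<theta> where \<theta>: "\<And>\<alpha> n. \<theta> \<alpha> \<in> R \<alpha> n" by blast
  have nbhd: "\<exists>n. R \<alpha> n \<subseteq> U" if U: "open U" "\<theta> \<alpha> \<in> U" for U \<alpha>
  proof -
    obtain e where e: "e > 0" "ball (\<theta> \<alpha>) e \<subseteq> U" using U open_contains_ball by blast
    obtain n where "\<forall>u \<in> R \<alpha> n. \<forall>v \<in> R \<alpha> n. dist u v < e" using R_small[OF e(1)] by blast
    then have "R \<alpha> n \<subseteq> ball (\<theta> \<alpha>) e" using \<theta> by auto
    then show ?thesis using e(2) by blast
  qed
  have "R \<alpha> 0 = F" for \<alpha> using S0(1)[of 0] by (simp add: R_def T_def P_def)
  then have "range \<theta> \<subseteq> F" using \<theta>[of _ 0] by auto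
  \<comment> \<open>Otherwise, at a late level, the sets of the two branches would be mapped by
    \<open>a\<close> into disjoint open sets. But a tuple in the fibre product has an entry in each
    of these sets, both with the same \<open>a\<close>-value.\<close>
  moreover have "a (\<theta> \<alpha>) = a (\<theta> \<beta>)" for \<alpha> \<beta>
  proof (rule ccontr)
    assume "a (\<theta> \<alpha>) \<noteq> a (\<theta> \<beta>)"
    from hausdorff[OF this] obtain U V where UV: "open U" "open V" "a (\<theta> \<alpha>) \<in> U" "a (\<theta> \<beta>) \<in> V" "U \<inter> V = {}"
      by (elim exE conjE)
    have "open (a -` U)" "open (a -` V)" using UV a by (auto simp: continuous_on_open_vimage)
    then obtain n1 n2 where "R \<alpha> n1 \<subseteq> a -` U" "R \<beta> n2 \<subseteq> a -` V"
      using nbhd[of "a -` U" \<alpha>] nbhd[of "a -` V" \<beta>] UV by auto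
    then have "R \<alpha> (max n1 n2) \<subseteq> a -` U" "R \<beta> (max n1 n2) \<subseteq> a -` V"
      using R_anti[of n1 "max n1 n2" \<alpha>] R_anti[of n2 "max n1 n2" \<beta>] by auto
    moreover obtain z where z: "\<forall>i<2 ^ max n1 n2. z i \<in> T (2 ^ max n1 n2) i \<and> a (z i) = a (z 0)"
      using T_fib[of "2 ^ max n1 n2", OF zero_less_power[OF zero_less_numeral]] by (elim exE)
    have "z (c \<gamma> (max n1 n2)) \<in> R \<gamma> (max n1 n2) \<and> a (z (c \<gamma> (max n1 n2))) = a (z 0)" for \<gamma>
      unfolding R_def using z c_less by blast
    from this[of \<alpha>] this[of \<beta>]
    have "z (c \<alpha> (max n1 n2)) \<in> R \<alpha> (max n1 n2)" "z (c \<beta> (max n1 n2)) \<in> R \<beta> (max n1 n2)"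
      "a (z (c \<alpha> (max n1 n2))) = a (z (c \<beta> (max n1 n2)))"
      by simp_all
    ultimately show False using UV(5) by (metis IntI empty_iff subsetD vimageE)
  qed
  \<comment> \<open>At the first difference one branch stays at coordinate \<open>p k\<close> and
    the other moves to \<open>k\<close>; the \<open>b\<close>-images of these two were made disjoint
    when \<open>k\<close> was created.\<close>
  moreover have neq: "b (\<theta> \<alpha>) \<noteq> b (\<theta> \<beta>)" if "\<And>i. i < n \<Longrightarrow> \<alpha> i = \<beta> i" "\<not> \<alpha> n" "\<beta> n" for \<alpha> \<beta> n
  proof -
    define k where "k = 2 ^ n + c \<alpha> n"
    have k: "Suc k \<le> 2 ^ Suc n" using c_less[of \<alpha> n] by (simp add: k_def)
    have "c \<beta> (Suc n) = k" "c \<alpha> (Suc n) = c \<alpha> n"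
      using that c_cong[of n \<alpha> \<beta>] by (simp_all add: c_Suc k_def)
    then have "R \<alpha> (Suc n) \<subseteq> T (Suc k) (p k)" "R \<beta> (Suc n) \<subseteq> T (Suc k) k"
      using T_anti[OF k] p_eq[OF c_less[of \<alpha> n]] by (auto simp: R_def k_def)
    then show ?thesis using T_new(2)[of k] \<theta>[of \<alpha> "Suc n"] \<theta>[of \<beta> "Suc n"] by (force simp: k_def)
  qed
  moreover have "inj (b \<circ> \<theta>)"
  proof (rule injI, rule ccontr)
    fix \<alpha> \<beta> assume eq: "(b \<circ> \<theta>) \<alpha> = (b \<circ> \<theta>) \<beta>" and "\<alpha> \<noteq> \<beta>"
    then obtain j where "\<alpha> j \<noteq> \<beta> j" by blast
    define n where "n = (LEAST j. \<alpha> j \<noteq> \<beta> j)"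
    have n: "\<alpha> n \<noteq> \<beta> n" "\<And>i. i < n \<Longrightarrow> \<alpha> i = \<beta> i"
      using LeastI[of "\<lambda>j. \<alpha> j \<noteq> \<beta> j", OF \<open>\<alpha> j \<noteq> \<beta> j\<close>] not_less_Least unfolding n_def by auto
    show False
      using n eq neq[of n \<alpha> \<beta>] neq[of n \<beta> \<alpha>] by (cases "\<alpha> n") auto
  qed
  moreover have "\<exists>n. \<forall>\<beta>. (\<forall>i<n. \<beta> i = \<alpha> i) \<longrightarrow> \<theta> \<beta> \<in> U" if U: "open U" "\<theta> \<alpha> \<in> U" for U \<alpha>
  proof -
    obtain n where n: "R \<alpha> n \<subseteq> U" using nbhd[OF U] by blast
    have "\<theta> \<beta> \<in> U" if "\<forall>i<n. \<beta> i = \<alpha> i" for \<beta>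
    proof -
      have "R \<beta> n = R \<alpha> n" using c_cong[of n \<beta> \<alpha>] that by (simp add: R_def)
      then show ?thesis using \<theta>[of \<beta> n] n by auto
    qed
    then show ?thesis by blast
  qed
  ultimately show ?thesis
    by (intro exI[of _ "a (\<theta> (\<lambda>_. False))"] exI[of _ \<theta>]) blast
qed

section \<open>Borel sets with countable sections\<close>

lemma uncountable_UNIV_nat_bool: "uncountable (UNIV :: (nat \<Rightarrow> bool) set)"
proof
  assume c: "countable (UNIV :: (nat \<Rightarrow> bool) set)"
  define \<alpha> where "\<alpha> = (\<lambda>n. \<not> from_nat_into (UNIV :: (nat \<Rightarrow> bool) set) n n)"
  obtain n where "from_nat_into UNIV n = \<alpha>" using from_nat_into_surj[OF c, of \<alpha>] by auto
  then show False by (metis \<alpha>_def)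
qed

text \<open>\<open>P\<close> is the projection of a closed \<open>F\<close>, with \<open>a\<close>
  and \<open>b\<close> the two coordinates of the projected point. The Cantor set offered by the
  dichotomy would inject into a single section of \<open>P\<close>, which is countable.\<close>

theorem Lusin_Novikov:
  fixes P :: "('x::{complete_space,second_countable_topology} \<times> (nat \<Rightarrow> real)) set"
  assumes P: "P \<in> sets borel" and sect: "\<And>x. countable {y. (x, y) \<in> P}"
  shows "\<exists>g :: nat \<Rightarrow> 'x \<Rightarrow> nat \<Rightarrow> real. (\<forall>n. g n \<in> borel_measurable borel) \<and> (\<forall>(x, y) \<in> P. \<exists>n. y = g n x)"
proof (rule ccontr)
  assume no: "\<not> ?thesis"
  obtain F :: "(('x \<times> (nat \<Rightarrow> real)) \<times> (nat \<Rightarrow> real)) set" where F: "closed F" "P = fst ` F"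
    using borel_eq_projection_of_closed[OF P] by auto
  have c: "continuous_on UNIV (\<lambda>z :: ('x \<times> (nat \<Rightarrow> real)) \<times> (nat \<Rightarrow> real). fst (fst z))"
    "continuous_on UNIV (\<lambda>z :: ('x \<times> (nat \<Rightarrow> real)) \<times> (nat \<Rightarrow> real). snd (fst z))"
    by (intro continuous_on_fst continuous_on_snd continuous_on_id)+
  have nc: "\<not> (\<exists>g :: nat \<Rightarrow> 'x \<Rightarrow> nat \<Rightarrow> real. (\<forall>n. g n \<in> borel_measurable borel) \<and>
      (\<forall>z \<in> F. \<exists>n. snd (fst z) = g n (fst (fst z))))"
    using no unfolding F(2) by (simp add: case_prod_beta)
  from Lusin_Novikov_dichotomy[OF c F(1) nc]
  obtain x and \<theta> :: "(nat \<Rightarrow> bool) \<Rightarrow> ('x \<times> (nat \<Rightarrow> real)) \<times> (nat \<Rightarrow> real)"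
    where \<theta>: "range \<theta> \<subseteq> F" "\<forall>\<alpha>. fst (fst (\<theta> \<alpha>)) = x" "inj ((\<lambda>z. snd (fst z)) \<circ> \<theta>)"
    by (elim exE conjE)
  have "(x, snd (fst (\<theta> \<alpha>))) \<in> P" for \<alpha>
  proof -
    have "fst (\<theta> \<alpha>) \<in> P" using \<theta>(1) F(2) by auto
    then show ?thesis using \<theta>(2) by (metis prod.collapse)
  qed
  then have "range ((\<lambda>z. snd (fst z)) \<circ> \<theta>) \<subseteq> {y. (x, y) \<in> P}" by auto
  then have "countable (range ((\<lambda>z. snd (fst z)) \<circ> \<theta>))" using sect countable_subset by blast
  then show False using countable_image_inj_on[OF _ \<theta>(3)] uncountable_UNIV_nat_bool by blast
qed

text \<open>The projection is the union over \<open>n\<close> of the sets of \<open>x\<close> with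
  \<open>(x, g n x)\<close> in \<open>P\<close>, and these are Borel.\<close>

corollary borel_projection_countable_sections:
  fixes P :: "('x::{complete_space,second_countable_topology} \<times> (nat \<Rightarrow> real)) set"
  assumes P: "P \<in> sets borel" and sect: "\<And>x. countable {y. (x, y) \<in> P}"
  shows "fst ` P \<in> sets borel"
proof -
  obtain g :: "nat \<Rightarrow> 'x \<Rightarrow> nat \<Rightarrow> real" where g: "\<forall>n. g n \<in> borel_measurable borel" "\<forall>(x, y) \<in> P. \<exists>n. y = g n x"
    using Lusin_Novikov[OF assms] by (elim exE conjE)
  have [measurable]: "g n \<in> borel_measurable borel" for n using g(1) by simp
  have "(\<lambda>x. (x, g n x)) -` P \<inter> space borel \<in> sets borel" for n
    by (rule measurable_sets[OF _ P]) measurable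
  moreover have "fst ` P = (\<Union>n. (\<lambda>x. (x, g n x)) -` P)" using g(2) by force
  ultimately show ?thesis by auto
qed

text \<open>By injectivity the transposed graph of \<open>f\<close> over \<open>B\<close> has
  sections of at most one point, and the image is its projection.\<close>

corollary Lusin_Souslin:
  fixes f :: "(nat \<Rightarrow> real) \<Rightarrow> 'x::{complete_space,second_countable_topology}"
  assumes f: "f \<in> borel_measurable borel" and B: "B \<in> sets borel" and inj: "inj_on f B"
  shows "f ` B \<in> sets borel"
proof -
  define P where "P = {p. snd p \<in> B \<and> f (snd p) = fst p}"
  note f[measurable] B[measurable]
  have "{p \<in> space (borel :: ('x \<times> (nat \<Rightarrow> real)) measure). f (snd p) = fst p} \<in> sets borel"
    unfolding borel_prod[symmetric] by measurable
  moreover have "snd -` B \<inter> space (borel :: ('x \<times> (nat \<Rightarrow> real)) measure) \<in> sets borel"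
    unfolding borel_prod[symmetric] by measurable
  ultimately have "P \<in> sets borel"
    by (simp add: P_def Collect_conj_eq vimage_def)
  moreover have "countable {y. (x, y) \<in> P}" for x
  proof -
    have "y = y'" if "y \<in> {y. (x, y) \<in> P}" "y' \<in> {y. (x, y) \<in> P}" for y y'
      using that inj by (auto simp: P_def inj_on_def)
    then have "{y. (x, y) \<in> P} = {} \<or> (\<exists>y. {y. (x, y) \<in> P} = {y})" by blast
    then show ?thesis by (metis countable_empty countable_insert)
  qed
  ultimately have "fst ` P \<in> sets borel" by (rule borel_projection_countable_sections)
  moreover have "fst ` P = f ` B"
  proof (intro set_eqI iffI)
    fix x assume "x \<in> f ` B"
    then obtain y where "y \<in> B" "x = f y" by blast
    then have "(x, y) \<in> P" by (simp add: P_def)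
    then show "x \<in> fst ` P" by force
  qed (auto simp: P_def)
  ultimately show ?thesis by simp
qed

section \<open>Borel isomorphism\<close>

text \<open>Codes a sequence of reals by a binary sequence. It serves to embed
  \<open>nat \<Rightarrow> real\<close> into Cantor space and to obtain countably many sets
  separating points.\<close>

lemma rational_cuts_injective:
  "inj (\<lambda>(y :: nat \<Rightarrow> real) (k::nat). case from_nat k of (n::nat, q::rat) \<Rightarrow> y n < of_rat q)"
proof (rule injI, rule ext, rule ccontr)
  fix y y' :: "nat \<Rightarrow> real" and n
  assume eq: "(\<lambda>(k::nat). case from_nat k of (n::nat, q::rat) \<Rightarrow> y n < of_rat q) =
    (\<lambda>(k::nat). case from_nat k of (n::nat, q::rat) \<Rightarrow> y' n < of_rat q)"
  have cuts: "y n < of_rat q \<longleftrightarrow> y' n < of_rat q" for q :: rat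
    using fun_cong[OF eq, of "to_nat (n, q)"] by simp
  assume "y n \<noteq> y' n"
  then consider "y n < y' n" | "y' n < y n" by linarith
  then show False
  proof cases
    case 1
    then obtain q where "y n < of_rat q" "of_rat q < y' n" using of_rat_dense by blast
    then show False using cuts[of q] by simp
  next
    case 2
    then obtain q where "y' n < of_rat q" "of_rat q < y n" using of_rat_dense by blast
    then show False using cuts[of q] by simp
  qed
qed

text \<open>The dichotomy is applied with the constant base map 0, so that the only section is
  \<open>B\<close> itself, and a cover by the points \<open>g n 0\<close> would make it countable.
  The resulting copy of Cantor space receives \<open>nat \<Rightarrow> real\<close> through rational
  cuts.\<close>

lemma uncountable_borel_embedding:
  fixes B :: "(nat \<Rightarrow> real) set"
  assumes B: "B \<in> sets borel" and unc: "uncountable B"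
  shows "\<exists>\<phi> :: (nat \<Rightarrow> real) \<Rightarrow> nat \<Rightarrow> real. \<phi> \<in> borel_measurable borel \<and> inj \<phi> \<and> range \<phi> \<subseteq> B"
proof -
  obtain F :: "((nat \<Rightarrow> real) \<times> (nat \<Rightarrow> real)) set" where F: "closed F" "B = fst ` F"
    using borel_eq_projection_of_closed[OF B] by auto
  have c: "continuous_on UNIV (\<lambda>z :: (nat \<Rightarrow> real) \<times> (nat \<Rightarrow> real). 0 :: real)"
    "continuous_on UNIV (fst :: (nat \<Rightarrow> real) \<times> (nat \<Rightarrow> real) \<Rightarrow> _)"
    by (intro continuous_on_fst continuous_on_const continuous_on_id)+
  have nc: "\<not> (\<exists>g :: nat \<Rightarrow> real \<Rightarrow> nat \<Rightarrow> real. (\<forall>n. g n \<in> borel_measurable borel) \<and>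
      (\<forall>z \<in> F. \<exists>n. fst z = g n 0))"
  proof
    assume "\<exists>g :: nat \<Rightarrow> real \<Rightarrow> nat \<Rightarrow> real. (\<forall>n. g n \<in> borel_measurable borel) \<and>
      (\<forall>z \<in> F. \<exists>n. fst z = g n 0)"
    then obtain g :: "nat \<Rightarrow> real \<Rightarrow> nat \<Rightarrow> real" where "\<forall>z \<in> F. \<exists>n. fst z = g n 0" by blast
    then have "B \<subseteq> range (\<lambda>n. g n 0)" using F(2) by auto
    then show False using unc by (meson countable_subset countable_image countableI_type)
  qed
  from Lusin_Novikov_dichotomy[OF c F(1) nc]
  obtain \<theta> :: "(nat \<Rightarrow> bool) \<Rightarrow> (nat \<Rightarrow> real) \<times> (nat \<Rightarrow> real)"
    where \<theta>: "range \<theta> \<subseteq> F" "inj (fst \<circ> \<theta>)"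
      "\<forall>U \<alpha>. open U \<longrightarrow> \<theta> \<alpha> \<in> U \<longrightarrow> (\<exists>n. \<forall>\<beta>. (\<forall>i<n. \<beta> i = \<alpha> i) \<longrightarrow> \<theta> \<beta> \<in> U)"
    by (elim exE conjE)
  define enc where "enc = (\<lambda>(y :: nat \<Rightarrow> real) (k::nat). case from_nat k of (n::nat, q::rat) \<Rightarrow> y n < of_rat q)"
  have enc_sets: "{y. enc y k} \<in> sets borel" for k
  proof (cases "from_nat k :: nat \<times> rat")
    case (Pair n q)
    have "{y :: nat \<Rightarrow> real. y n < of_rat q} \<in> sets borel" by measurable
    then show ?thesis using Pair by (simp add: enc_def)
  qed
  define \<phi> where "\<phi> = (\<lambda>y. fst (\<theta> (enc y)))"
  have "inj \<phi>"
    using inj_compose[OF \<theta>(2) rational_cuts_injective] by (simp add: \<phi>_def enc_def comp_def)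
  moreover have "range \<phi> \<subseteq> B" using \<theta>(1) F(2) by (auto simp: \<phi>_def)
  moreover have "\<phi> \<in> borel_measurable borel"
  proof (rule borel_measurableI)
    fix U :: "(nat \<Rightarrow> real) set" assume U: "open U"
    \<comment> \<open>Finite words all of whose extensions are sent into \<open>U\<close>. By
      continuity of \<theta> they exhaust the preimage of \<open>U\<close>, and there are countably
      many of them.\<close>
    define L where "L = {l :: bool list. \<forall>\<beta>. (\<forall>i<length l. \<beta> i = l ! i) \<longrightarrow> fst (\<theta> \<beta>) \<in> U}"
    have opn: "open (fst -` U :: ((nat \<Rightarrow> real) \<times> (nat \<Rightarrow> real)) set)"
      using U by (simp add: open_vimage_fst)
    have "\<phi> -` U = (\<Union>l \<in> L. \<Inter>i \<in> {..<length l}. {y. enc y i = l ! i})"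
    proof (intro set_eqI iffI)
      fix y assume "y \<in> \<phi> -` U"
      then have "\<theta> (enc y) \<in> fst -` U" by (simp add: \<phi>_def)
      then obtain n where n: "\<forall>\<beta>. (\<forall>i<n. \<beta> i = enc y i) \<longrightarrow> \<theta> \<beta> \<in> fst -` U"
        using \<theta>(3) opn by blast
      then have "map (enc y) [0..<n] \<in> L" by (auto simp: L_def)
      then show "y \<in> (\<Union>l \<in> L. \<Inter>i \<in> {..<length l}. {y. enc y i = l ! i})"
        by (intro UN_I[of "map (enc y) [0..<n]"]) auto
    next
      fix y assume "y \<in> (\<Union>l \<in> L. \<Inter>i \<in> {..<length l}. {y. enc y i = l ! i})"
      then obtain l where "l \<in> L" "\<forall>i<length l. enc y i = l ! i" by auto
      then show "y \<in> \<phi> -` U" by (auto simp: L_def \<phi>_def)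
    qed
    moreover have "(\<Inter>i \<in> {..<length l}. {y. enc y i = l ! i}) \<in> sets borel" for l
    proof (cases "l = []")
      case False
      have "{y. enc y i = l ! i} \<in> sets borel" for i
      proof (cases "l ! i")
        case True
        then show ?thesis using enc_sets[of i] by simp
      next
        case False
        then show ?thesis using borel_comp[OF enc_sets[of i]] by (simp add: Collect_neg_eq)
      qed
      then show ?thesis using False by (intro sets.finite_INT) auto
    qed simp
    ultimately show "\<phi> -` U \<inter> space borel \<in> sets borel"
      by (simp add: sets.countable_UN'')
  qed
  ultimately show ?thesis by blast
qed

text \<open>The Cantor-Bernstein argument with Borel embeddings in both directions; by
  \<open>Lusin_Souslin\<close> every set that occurs in it is Borel.\<close>

theorem borel_isomorphism:
  fixes A B :: "(nat \<Rightarrow> real) set"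
  assumes A: "A \<in> sets borel" "uncountable A" and B: "B \<in> sets borel" "uncountable B"
  shows "\<exists>h. bij_betw h A B \<and> (\<forall>D \<in> sets borel. {x \<in> A. h x \<in> D} \<in> sets borel)"
proof -
  obtain f :: "(nat \<Rightarrow> real) \<Rightarrow> nat \<Rightarrow> real" where f: "f \<in> borel_measurable borel" "inj f" "range f \<subseteq> B"
    using uncountable_borel_embedding[OF B] by blast
  obtain g :: "(nat \<Rightarrow> real) \<Rightarrow> nat \<Rightarrow> real" where g: "g \<in> borel_measurable borel" "inj g" "range g \<subseteq> A"
    using uncountable_borel_embedding[OF A] by blast
  have f_im: "f ` D \<in> sets borel" and g_im: "g ` D \<in> sets borel" if "D \<in> sets borel" for D
    using Lusin_Souslin f g that by (meson inj_on_subset subset_UNIV)+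
  \<comment> \<open>Iterates of \<open>g \<circ> f\<close> on the part of \<open>A\<close> missed by
    \<open>g\<close> on \<open>B\<close>. The bijection follows \<open>f\<close> on their union
    \<open>Y\<close> and the inverse of \<open>g\<close> elsewhere.\<close>
  define X where "X = rec_nat (A - g ` B) (\<lambda>_ D. g ` f ` D)"
  have X_borel: "X n \<in> sets borel" for n
    by (induction n) (auto simp: X_def intro!: f_im g_im A B)
  define Y where "Y = (\<Union>n. X n)"
  have Y: "Y \<in> sets borel" using X_borel by (auto simp: Y_def)
  have Y_sub: "Y \<subseteq> A"
  proof -
    have "X n \<subseteq> A" for n using g(3) by (cases n) (auto simp: X_def)
    then show ?thesis by (auto simp: Y_def)
  qed
  have Y_fix: "Y = (A - g ` B) \<union> g ` f ` Y"
  proof -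
    have "Y = X 0 \<union> (\<Union>n. X (Suc n))" unfolding Y_def
      by (auto, metis not0_implies_Suc)
    also have "(\<Union>n. X (Suc n)) = g ` f ` Y" by (simp add: X_def Y_def image_UN)
    finally show ?thesis by (simp add: X_def)
  qed
  define Z where "Z = B - f ` Y"
  have Z: "Z \<in> sets borel" using B f_im[OF Y] by (auto simp: Z_def)
  have "g ` Z = g ` B - g ` f ` Y" unfolding Z_def using g(2) by (simp add: image_set_diff)
  also have "\<dots> = A - Y"
  proof -
    have "g ` B \<subseteq> A" using g(3) by blast
    moreover have "g ` f ` Y \<subseteq> g ` B" using f(3) by blast
    ultimately show ?thesis using Y_fix by blast
  qed
  finally have gZ: "g ` Z = A - Y" .
  define h where "h = (\<lambda>x. if x \<in> Y then f x else inv g x)"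
  have inv_g: "inv g (g z) = z" for z using g(2) by simp
  have "bij_betw h Y (f ` Y)"
    using f(2) by (auto simp: bij_betw_def inj_on_def h_def)
  moreover have "bij_betw h (A - Y) Z"
    unfolding gZ[symmetric]
  proof (rule bij_betw_imageI)
    have h: "h (g z) = z" if "z \<in> Z" for z
    proof -
      have "g z \<in> A - Y" using gZ that by blast
      then show ?thesis by (simp add: h_def inv_g)
    qed
    then show "inj_on h (g ` Z)" by (auto simp: inj_on_def)
    show "h ` g ` Z = Z" using h by (force simp: image_image)
  qed
  moreover have "f ` Y \<inter> Z = {}" by (auto simp: Z_def)
  ultimately have "bij_betw h (Y \<union> (A - Y)) (f ` Y \<union> Z)" by (rule bij_betw_combine)
  moreover have "Y \<union> (A - Y) = A" using Y_sub by blast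
  moreover have "f ` Y \<union> Z = B" using f(3) by (auto simp: Z_def)
  ultimately have "bij_betw h A B" by simp
  moreover have "{x \<in> A. h x \<in> D} \<in> sets borel" if D: "D \<in> sets borel" for D
  proof -
    have "{x \<in> A - Y. inv g x \<in> D} = g ` (Z \<inter> D)"
      unfolding gZ[symmetric] by (auto simp: inv_g)
    then have "{x \<in> A. h x \<in> D} = (Y \<inter> f -` D) \<union> g ` (Z \<inter> D)"
      using Y_sub by (auto simp: h_def)
    moreover have "f -` D \<inter> space borel \<in> sets borel" using f(1) D by (rule measurable_sets)
    ultimately show ?thesis using Y Z D by (auto intro!: g_im)
  qed
  ultimately show ?thesis by blast
qed

section \<open>Standard Borel spaces\<close>

text \<open>A point is coded by its distances to a dense sequence. Completeness describes the range
  by countably many inequalities, so it is Borel; balls around the dense points go to sets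
  \<open>{y \<in> G. y n < r}\<close>, and injectivity carries this over to all measurable
  sets.\<close>

lemma standard_borel_embedding:
  assumes "standard_borel_space M" and ne: "space M \<noteq> {}"
  shows "\<exists>e :: 'a \<Rightarrow> nat \<Rightarrow> real. e \<in> borel_measurable M \<and> inj_on e (space M) \<and> (\<forall>B \<in> sets M. e ` B \<in> sets borel)"
proof -
  obtain T where T: "topspace T = space M" "completely_metrizable_space T" "separable_space T"
    and sets_M: "sets M = sigma_sets (space M) {U. openin T U}"
    using assms(1) unfolding standard_borel_space_def by blast
  obtain X d where "Metric_space X d" and mc: "Metric_space.mcomplete X d" and T_eq: "T = Metric_space.mtopology X d"
    using T(2) unfolding completely_metrizable_space_def by blast
  then interpret Metric_space X d by simp
  have X: "X = space M" using T(1) T_eq by simp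
  obtain C where C: "countable C" "C \<subseteq> X" "mtopology closure_of C = X"
    using T(3) unfolding separable_space_def T_eq by auto
  have dense_C: "\<exists>c\<in>C. d x c < r" if "x \<in> X" "r > 0" for x r
    using that C(3) unfolding metric_closure_of by auto
  have "C \<noteq> {}" using dense_C[of _ 1] ne X by fastforce
  define q where "q = from_nat_into C"
  have q: "q n \<in> X" for n
    using from_nat_into[OF \<open>C \<noteq> {}\<close>, of n] C(2) by (auto simp: q_def)
  have dense: "\<exists>n. d x (q n) < r" if "x \<in> X" "r > 0" for x r
    using dense_C[OF that] from_nat_into_surj[OF C(1)] unfolding q_def by metis
  define e where "e = (\<lambda>x n. d x (q n))"
  have e_meas: "e \<in> borel_measurable M"
  proof (rule measurable_coordinatewise_then_product)
    fix n show "(\<lambda>x. e x n) \<in> borel_measurable M"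
    proof (rule borel_measurableI_less)
      fix r
      have "{x \<in> space M. e x n < r} = mball (q n) r"
        using q by (auto simp: e_def commute simp flip: X)
      then show "{x \<in> space M. e x n < r} \<in> sets M"
        using sets_M T_eq by (auto intro: sigma_sets.Basic)
    qed
  qed
  have inj: "inj_on e (space M)"
  proof (rule inj_onI, rule ccontr)
    fix x y assume xy: "x \<in> space M" "y \<in> space M" "e x = e y" "x \<noteq> y"
    then have "d x y > 0" using X by simp
    then obtain n where n: "d x (q n) < d x y / 2" using dense[of x "d x y / 2"] xy X by auto
    moreover have "d y (q n) = d x (q n)" using fun_cong[OF xy(3), of n] by (simp add: e_def)
    moreover have "d x y \<le> d x (q n) + d (q n) y" using xy X q by (intro triangle) auto
    ultimately show False by (simp add: commute)
  qed
  \<comment> \<open>The first two conditions are the triangle inequalities for a putative point at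
    distance \<open>y n\<close> from \<open>q n\<close>; the third says that the dense sequence
    approaches it. Points \<open>q (m k)\<close> with \<open>y (m k)\<close> tending to 0 then form
    a Cauchy sequence, and its limit realises \<open>y\<close>.\<close>
  define G where "G = {y. (\<forall>n m. y n \<le> d (q n) (q m) + y m) \<and> (\<forall>n m. d (q n) (q m) \<le> y n + y m) \<and> (\<forall>k. \<exists>n. y n < 1 / real (Suc k))}"
  have G_eq: "G = (\<Inter>n. \<Inter>m. {y. y n \<le> d (q n) (q m) + y m} \<inter> {y. d (q n) (q m) \<le> y n + y m}) \<inter>
      (\<Inter>k. \<Union>n. {y. y n < 1 / real (Suc k)})"
    by (auto simp: G_def)
  have "{y :: nat \<Rightarrow> real. y n \<le> d (q n) (q m) + y m} \<in> sets borel"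
    "{y :: nat \<Rightarrow> real. d (q n) (q m) \<le> y n + y m} \<in> sets borel"
    "{y :: nat \<Rightarrow> real. y n < r} \<in> sets borel" for n m r
    by (intro borel_closed borel_open closed_Collect_le open_Collect_less continuous_on_add
        continuous_on_const continuous_on_product_coordinates)+
  then have G_borel: "G \<in> sets borel"
    unfolding G_eq by (intro sets.Int sets.countable_INT'' sets.countable_UN'') auto
  have range_e: "e ` X = G"
  proof (intro set_eqI iffI)
    fix y assume "y \<in> e ` X"
    then obtain x where x: "x \<in> X" "y = e x" by blast
    have "d x (q n) \<le> d (q n) (q m) + d x (q m)" "d (q n) (q m) \<le> d x (q n) + d x (q m)" for n m
      using triangle[of x "q m" "q n"] triangle[of "q n" x "q m"] x(1) q commute by (auto simp: add.commute)
    moreover have "\<exists>n. d x (q n) < 1 / real (Suc k)" for k using dense[OF x(1)] by simp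
    ultimately show "y \<in> G" by (simp add: G_def x(2) e_def)
  next
    fix y assume y: "y \<in> G"
    then have "\<forall>k. \<exists>n. y n < 1 / real (Suc k)" by (simp add: G_def)
    from choice[OF this] obtain m where m: "\<And>k. y (m k) < 1 / real (Suc k)" by blast
    have y1: "y n \<le> d (q n) (q j) + y j" and y2: "d (q n) (q j) \<le> y n + y j" for n j
      using y by (simp_all add: G_def)
    have "MCauchy (q \<circ> m)"
      unfolding MCauchy_def
    proof (intro conjI allI impI)
      show "range (q \<circ> m) \<subseteq> X" using q by auto
      fix r :: real assume "r > 0"
      then obtain N where N: "1 / real (Suc N) < r / 2" using nat_approx_posE[of "r/2"] by auto
      have small: "y (m k) < r / 2" if "N \<le> k" for k
      proof -
        have "1 / real (Suc k) \<le> 1 / real (Suc N)" using that by (simp add: frac_le)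
        then show ?thesis using m[of k] N by simp
      qed
      have "d ((q \<circ> m) k) ((q \<circ> m) l) < r" if "N \<le> k" "N \<le> l" for k l
        using y2[of "m k" "m l"] small[OF that(1)] small[OF that(2)] by simp
      then show "\<exists>N. \<forall>n n'. N \<le> n \<longrightarrow> N \<le> n' \<longrightarrow> d ((q \<circ> m) n) ((q \<circ> m) n') < r" by blast
    qed
    then obtain x where x: "limitin mtopology (q \<circ> m) x sequentially"
      using mc unfolding mcomplete_def by blast
    then have xX: "x \<in> X" by (simp add: limitin_def)
    have close: "\<exists>k. d x (q (m k)) < r \<and> y (m k) < r" if r: "r > 0" for r
    proof -
      obtain N where N: "1 / real (Suc N) < r" using nat_approx_posE[OF r] by auto
      have "\<forall>\<^sub>F k in sequentially. (q \<circ> m) k \<in> mball x r"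
        using x xX r unfolding limitin_def by auto
      then obtain N' where N': "\<And>k. k \<ge> N' \<Longrightarrow> q (m k) \<in> mball x r"
        unfolding eventually_sequentially by auto
      have "1 / real (Suc (max N N')) \<le> 1 / real (Suc N)" by (simp add: frac_le)
      then have "y (m (max N N')) < r" using m[of "max N N'"] N by simp
      moreover have "d x (q (m (max N N'))) < r" using N'[of "max N N'"] by simp
      ultimately show ?thesis by blast
    qed
    have "y n = d x (q n)" for n
    proof (rule antisym)
      show "y n \<le> d x (q n)"
      proof (rule field_le_epsilon)
        fix r :: real assume "r > 0"
        then obtain k where k: "d x (q (m k)) < r / 2" "y (m k) < r / 2" using close[of "r/2"] by auto
        have "d (q n) (q (m k)) \<le> d (q n) x + d x (q (m k))" using q xX by (intro triangle)
        then show "y n \<le> d x (q n) + r" using y1[of n "m k"] k by (simp add: commute)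
      qed
      show "d x (q n) \<le> y n"
      proof (rule field_le_epsilon)
        fix r :: real assume "r > 0"
        then obtain k where k: "d x (q (m k)) < r / 2" "y (m k) < r / 2" using close[of "r/2"] by auto
        have "d x (q n) \<le> d x (q (m k)) + d (q (m k)) (q n)" using q xX by (intro triangle)
        then show "d x (q n) \<le> y n + r" using y2[of "m k" n] k by simp
      qed
    qed
    then have "y = e x" by (auto simp: e_def)
    then show "y \<in> e ` X" using xX by blast
  qed
  have "e ` B \<in> sets borel" if "B \<in> sets M" for B
  proof -
    have "B \<in> sigma_sets (space M) {U. openin T U}" using that sets_M by simp
    then show ?thesis
    proof (induction)
      case (Basic U)
      then have U: "openin mtopology U" by (simp add: T_eq)
      define J where "J = {(n, k). mball (q n) (1 / real (Suc k)) \<subseteq> U}"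
      have "U = (\<Union>(n, k) \<in> J. mball (q n) (1 / real (Suc k)))"
      proof (intro set_eqI iffI)
        fix x assume x: "x \<in> U"
        then have xX: "x \<in> X" using U by (auto simp: openin_mtopology)
        obtain r where r: "r > 0" "mball x r \<subseteq> U" using U x by (auto simp: openin_mtopology)
        obtain k where k: "1 / real (Suc k) < r / 2" using nat_approx_posE[of "r/2"] r(1) by auto
        obtain n where n: "d x (q n) < 1 / real (Suc k)" using dense[OF xX, of "1 / real (Suc k)"] by auto
        have "mball (q n) (1 / real (Suc k)) \<subseteq> mball x r"
        proof
          fix z assume "z \<in> mball (q n) (1 / real (Suc k))"
          then have z: "z \<in> X" "d (q n) z < 1 / real (Suc k)" by auto
          have "d x z \<le> d x (q n) + d (q n) z" using xX z q by (intro triangle)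
          then have "d x z < r" using z n k by linarith
          then show "z \<in> mball x r" using xX z by simp
        qed
        then have "(n, k) \<in> J" using r(2) by (auto simp: J_def)
        moreover have "x \<in> mball (q n) (1 / real (Suc k))" using n xX q commute by simp
        ultimately show "x \<in> (\<Union>(n, k) \<in> J. mball (q n) (1 / real (Suc k)))" by (intro UN_I[of "(n, k)"]) simp_all
      qed (auto simp: J_def)
      then have "e ` U = (\<Union>p \<in> J. e ` mball (q (fst p)) (1 / real (Suc (snd p))))"
        by (simp add: image_UN case_prod_beta)
      moreover have "e ` mball (q n) r \<in> sets borel" for n r
      proof -
        have "e ` mball (q n) r = G \<inter> {y. y n < r}"
          unfolding range_e[symmetric] using q by (auto simp: e_def commute)
        moreover have "{y :: nat \<Rightarrow> real. y n < r} \<in> sets borel"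
          by (intro borel_open open_Collect_less continuous_on_const continuous_on_product_coordinates)
        ultimately show ?thesis using G_borel by auto
      qed
      ultimately show ?case by (simp add: sets.countable_UN'')
    next
      case Empty
      then show ?case by simp
    next
      case (Compl B)
      have "B \<subseteq> space M"
        using sigma_sets_into_sp[OF _ Compl.hyps] T(1) openin_subset by (metis Pow_iff mem_Collect_eq subsetI)
      then have "e ` (space M - B) = G - e ` B"
        unfolding range_e[symmetric] X using inj by (simp add: inj_on_image_set_diff)
      then show ?case using Compl.IH G_borel by auto
    next
      case (Union B)
      then show ?case by (simp add: image_UN sets.countable_UN'')
    qed
  qed
  then show ?thesis using e_meas inj by (intro exI[of _ e] conjI ballI)
qed

text \<open>A total left inverse, constant off the range of \<open>e\<close>. It is measurable
  because \<open>e\<close> maps measurable sets to Borel sets, and it moves arguments on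
  \<open>M\<close> to \<open>nat \<Rightarrow> real\<close> and back.\<close>

lemma standard_borel_retraction:
  fixes e :: "'a \<Rightarrow> nat \<Rightarrow> real"
  assumes inj: "inj_on e (space M)" and im: "\<And>B. B \<in> sets M \<Longrightarrow> e ` B \<in> sets borel" and ne: "space M \<noteq> {}"
  shows "\<exists>j \<in> measurable borel M. \<forall>x \<in> space M. j (e x) = x"
proof -
  obtain x0 where x0: "x0 \<in> space M" using ne by blast
  define j where "j = (\<lambda>u. if u \<in> e ` space M then inv_into (space M) e u else x0)"
  have j_e: "j (e x) = x" if "x \<in> space M" for x
    using that inj by (simp add: j_def)
  have j_space: "j u \<in> space M" for u using x0 inv_into_into[of u e "space M"] by (simp add: j_def)
  have "j \<in> measurable borel M"
  proof (rule measurableI)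
    fix B assume B: "B \<in> sets M"
    have "j -` B = e ` B \<union> (if x0 \<in> B then - e ` space M else {})"
    proof (intro set_eqI iffI)
      fix u assume u: "u \<in> j -` B"
      show "u \<in> e ` B \<union> (if x0 \<in> B then - e ` space M else {})"
      proof (cases "u \<in> e ` space M")
        case True
        then obtain x where x: "x \<in> space M" "u = e x" by blast
        then show ?thesis using u j_e by auto
      next
        case False
        then show ?thesis using u by (auto simp: j_def)
      qed
    next
      fix u assume u: "u \<in> e ` B \<union> (if x0 \<in> B then - e ` space M else {})"
      show "u \<in> j -` B"
      proof (cases "u \<in> e ` B")
        case True
        then show ?thesis using j_e sets.sets_into_space[OF B] by auto
      next
        case False
        then show ?thesis using u by (auto simp: j_def split: if_splits)
      qed
    qed
    then show "j -` B \<inter> space borel \<in> sets borel"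
      using im[OF B] im[OF sets.top] by (auto intro: borel_comp)
  qed (rule j_space)
  then show ?thesis using j_e by blast
qed

section \<open>Markers\<close>

lemma measurable_surjection_on_classes:
  fixes f :: "nat \<Rightarrow> 'a \<Rightarrow> 'a" and V :: "nat \<Rightarrow> 'a set"
  assumes E: "equiv (space M) E" and f: "\<And>n. f n \<in> measurable M M"
    and cls: "\<And>x. x \<in> space M \<Longrightarrow> E `` {x} = range (\<lambda>n. f n x)"
    and inf: "\<And>x. x \<in> space M \<Longrightarrow> infinite (E `` {x})"
    and V: "\<And>n. V n \<in> sets M"
    and sep: "\<And>x y. x \<in> space M \<Longrightarrow> y \<in> space M \<Longrightarrow> (\<And>n. x \<in> V n \<longleftrightarrow> y \<in> V n) \<Longrightarrow> x = y"
  shows "\<exists>i \<in> measurable M (count_space (UNIV :: nat set)). \<forall>x \<in> space M. i ` (E `` {x}) = UNIV"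
proof -
  note f[measurable] V[measurable]
  have f_space: "f n x \<in> space M" if "x \<in> space M" for n x using f that by (rule measurable_space)
  have f_eq: "f n x = f m x \<longleftrightarrow> (\<forall>k. f n x \<in> V k \<longleftrightarrow> f m x \<in> V k)" if "x \<in> space M" for n m x
    using sep[OF f_space[OF that] f_space[OF that]] by metis
  \<comment> \<open>Infinitude is expressed with countable quantifiers only: arbitrarily late in the
    enumeration a new element of \<open>U\<close> appears. Equality of points is replaced by
    agreement on all \<open>V k\<close>, which makes the condition visibly measurable.\<close>
  have infinite_iff: "infinite (E `` {y} \<inter> U) \<longleftrightarrow>
      (\<forall>N. \<exists>n. f n y \<in> U \<and> (\<forall>m<N. \<not> (\<forall>k. f n y \<in> V k \<longleftrightarrow> f m y \<in> V k)))" if y: "y \<in> space M" for y U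
    unfolding f_eq[OF y, symmetric]
  proof
    assume i: "infinite (E `` {y} \<inter> U)"
    show "\<forall>N. \<exists>n. f n y \<in> U \<and> (\<forall>m<N. f n y \<noteq> f m y)"
    proof (rule ccontr)
      assume "\<not> ?thesis"
      then obtain N where "\<And>n. f n y \<in> U \<Longrightarrow> \<exists>m<N. f n y = f m y" by auto
      then have "E `` {y} \<inter> U \<subseteq> (\<lambda>m. f m y) ` {..<N}" unfolding cls[OF y] by blast
      then show False using i finite_subset by blast
    qed
  next
    assume r: "\<forall>N. \<exists>n. f n y \<in> U \<and> (\<forall>m<N. f n y \<noteq> f m y)"
    show "infinite (E `` {y} \<inter> U)"
    proof
      assume "finite (E `` {y} \<inter> U)"
      moreover have "E `` {y} \<inter> U \<subseteq> (\<lambda>m. f m y) ` UNIV" using cls[OF y] by auto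
      ultimately obtain I where I: "finite I" "E `` {y} \<inter> U = (\<lambda>m. f m y) ` I"
        using finite_subset_image by metis
      obtain N where N: "I \<subseteq> {..<N}" using I(1) finite_nat_iff_bounded by blast
      obtain n where n: "f n y \<in> U" "\<forall>m<N. f n y \<noteq> f m y" using r by blast
      then have "f n y \<in> E `` {y} \<inter> U" using cls[OF y] by auto
      then obtain m where "m \<in> I" "f n y = f m y" using I(2) by auto
      then show False using n(2) N by auto
    qed
  qed
  define Inf where "Inf = (\<lambda>U. {y \<in> space M. infinite (E `` {y} \<inter> U)})"
  have Inf_sets: "Inf U \<in> sets M" if U[measurable]: "U \<in> sets M" for U
  proof -
    have "Inf U = {y \<in> space M. \<forall>N. \<exists>n. f n y \<in> U \<and> (\<forall>m<N. \<not> (\<forall>k. f n y \<in> V k \<longleftrightarrow> f m y \<in> V k))}"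
      unfolding Inf_def using infinite_iff by blast
    also have "\<dots> \<in> sets M" by measurable
    finally show ?thesis .
  qed
  \<comment> \<open>Read the \<open>V n\<close> as binary digits: \<open>A n\<close> consists of the points agreeing for \<open>n\<close> digits with the
    lexicographically least accumulation point of their class.\<close>
  define A where "A = rec_nat (space M) (\<lambda>n A. (Inf (A - V n) \<inter> (A - V n)) \<union> (A \<inter> V n - Inf (A - V n)))"
  have A_0: "A 0 = space M" by (simp add: A_def)
  have A_Suc: "A (Suc n) = (Inf (A n - V n) \<inter> (A n - V n)) \<union> (A n \<inter> V n - Inf (A n - V n))" for n
    by (simp add: A_def)
  have A_sets[measurable]: "A n \<in> sets M" for n
  proof (induction n)
    case (Suc n)
    then show ?case unfolding A_Suc using Inf_sets[of "A n - V n"] by auto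
  qed (simp add: A_0)
  have A_anti: "A n \<subseteq> A m" if "m \<le> n" for m n
    by (rule lift_Suc_antimono_le[OF _ that]) (auto simp: A_Suc)
  have E_space: "z \<in> space M" if "z \<in> E `` {y}" "y \<in> space M" for y z
    using that cls f_space by auto
  have E_eq: "E `` {z} = E `` {y}" if "z \<in> E `` {y}" for y z
    using that equiv_class_eq[OF E] by auto
  have Inf_iff: "z \<in> Inf U \<longleftrightarrow> y \<in> Inf U" if "z \<in> E `` {y}" "y \<in> space M" for y z U
    using E_eq[OF that(1)] E_space[OF that] that(2) by (simp add: Inf_def)
  have A_inf: "infinite (E `` {y} \<inter> A n)" if y: "y \<in> space M" for y n
  proof (induction n)
    case 0
    have "E `` {y} \<inter> A 0 = E `` {y}" using E_space y by (auto simp: A_0)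
    then show ?case using inf[OF y] by simp
  next
    case (Suc n)
    show ?case
    proof (cases "y \<in> Inf (A n - V n)")
      case True
      then have "E `` {y} \<inter> A (Suc n) = E `` {y} \<inter> (A n - V n)"
        using Inf_iff[OF _ y] by (auto simp: A_Suc)
      then show ?thesis using True by (simp add: Inf_def)
    next
      case False
      then have "E `` {y} \<inter> A (Suc n) = E `` {y} \<inter> A n - E `` {y} \<inter> (A n - V n)"
        using Inf_iff[OF _ y] by (auto simp: A_Suc)
      moreover have "finite (E `` {y} \<inter> (A n - V n))" using False y by (simp add: Inf_def)
      ultimately show ?thesis using Suc by simp
    qed
  qed
  \<comment> \<open>For a point of \<open>A (Suc n)\<close>, membership in \<open>V n\<close>
    depends only on its class, because \<open>Inf\<close> is invariant. Two equivalent points lying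
    in all \<open>A n\<close> are therefore not separated by any \<open>V n\<close>.\<close>
  have A_unique: "z = z'" if y: "y \<in> space M" and z: "z \<in> E `` {y}" "z' \<in> E `` {y}"
    and zA: "\<And>n. z \<in> A n" "\<And>n. z' \<in> A n" for y z z'
  proof (rule sep)
    show "z \<in> space M" "z' \<in> space M" using E_space z y by auto
    show "z \<in> V n \<longleftrightarrow> z' \<in> V n" for n
      using zA[of "Suc n"] Inf_iff[OF z(1) y] Inf_iff[OF z(2) y] by (auto simp: A_Suc)
  qed
  \<comment> \<open>On the at most one point per class in all \<open>A n\<close>, \<open>LEAST\<close> yields a fixed junk value, which is harmless.\<close>
  define L where "L = (\<lambda>y. LEAST n. y \<notin> A n)"
  have L[measurable]: "L \<in> measurable M (count_space UNIV)" unfolding L_def by measurable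
  have L_inf: "infinite (L ` (E `` {y}))" if y: "y \<in> space M" for y
    unfolding infinite_nat_iff_unbounded
  proof
    fix N
    \<comment> \<open>The class meets \<open>A N\<close> in an infinite set, and at most one of its
      points lies in every \<open>A n\<close>. Any other point leaves only after stage
      \<open>N\<close>, so its value of \<open>L\<close> exceeds \<open>N\<close>.\<close>
    have "\<exists>z. z \<in> E `` {y} \<inter> A N \<and> \<not> (\<forall>n. z \<in> A n)"
    proof (rule ccontr)
      assume no: "\<not> ?thesis"
      have *: "z \<in> A n" if "z \<in> E `` {y} \<inter> A N" for z n using no that by blast
      have "E `` {y} \<inter> A N \<subseteq> {SOME z. z \<in> E `` {y} \<inter> A N}"
      proof
        fix w assume w: "w \<in> E `` {y} \<inter> A N"
        define w' where "w' = (SOME z. z \<in> E `` {y} \<inter> A N)"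
        have w': "w' \<in> E `` {y} \<inter> A N" unfolding w'_def using w by (rule someI)
        have "w = w'" by (rule A_unique[OF y]) (use w w' * in auto)
        then show "w \<in> {SOME z. z \<in> E `` {y} \<inter> A N}" by (simp add: w'_def)
      qed
      then have "finite (E `` {y} \<inter> A N)" using finite_subset by blast
      then show False using A_inf[OF y] by blast
    qed
    then obtain z n where z: "z \<in> E `` {y} \<inter> A N" and "z \<notin> A n" by blast
    from \<open>z \<notin> A n\<close> have "z \<notin> A (L z)" unfolding L_def by (rule LeastI)
    then have "N < L z" using z A_anti[of "L z" N] by (meson IntD2 linorder_not_less subsetD)
    then show "\<exists>n>N. n \<in> L ` (E `` {y})" using z by blast
  qed
  \<comment> \<open>\<open>F (L y) y\<close> is the rank of \<open>L y\<close> among the values of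
    \<open>L\<close> on the class, starting from 0. The bound \<open>l\<close> is kept as a
    parameter so that measurability follows by induction on \<open>l\<close>, and then for
    \<open>L y\<close> because \<open>L\<close> has countably many values.\<close>
  define F where "F = (\<lambda>l y. card {m. m < l \<and> (\<exists>n. L (f n y) = m)})"
  have F[measurable]: "F l \<in> measurable M (count_space UNIV)" for l
  proof (induction l)
    case (Suc l)
    have "F (Suc l) y = (if \<exists>n. L (f n y) = l then Suc (F l y) else F l y)" for y
    proof (cases "\<exists>n. L (f n y) = l")
      case True
      then have "{m. m < Suc l \<and> (\<exists>n. L (f n y) = m)} = insert l {m. m < l \<and> (\<exists>n. L (f n y) = m)}"
        by (auto simp: less_Suc_eq)
      then show ?thesis using True by (simp add: F_def)
    next
      case False
      then have "{m. m < Suc l \<and> (\<exists>n. L (f n y) = m)} = {m. m < l \<and> (\<exists>n. L (f n y) = m)}"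
        by (auto simp: less_Suc_eq)
      then show ?thesis using False by (simp add: F_def)
    qed
    moreover note Suc[measurable]
    have "(\<lambda>y. if \<exists>n. L (f n y) = l then Suc (F l y) else F l y) \<in> measurable M (count_space UNIV)"
      by measurable
    ultimately show ?case by (simp cong: measurable_cong)
  qed (simp add: F_def)
  define i where "i = (\<lambda>y. F (L y) y)"
  have "i \<in> measurable M (count_space UNIV)"
    unfolding i_def by (rule measurable_compose_countable[OF F L])
  moreover have "i ` (E `` {x}) = UNIV" if x: "x \<in> space M" for x
  proof (intro set_eqI iffI)
    fix k :: nat
    define K where "K = L ` (E `` {x})"
    have K: "infinite K" using L_inf[OF x] by (simp add: K_def)
    have "enumerate K k \<in> K" using range_enumerate[OF K] by auto
    then obtain y where y: "y \<in> E `` {x}" "L y = enumerate K k" by (auto simp: K_def)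
    have "K = range (\<lambda>n. L (f n y))"
      using cls[OF E_space[OF y(1) x]] E_eq[OF y(1)] by (simp add: K_def image_image)
    then have "i y = card {m. m < enumerate K k \<and> m \<in> K}"
      by (auto simp: i_def F_def y(2) intro!: arg_cong[of _ _ card])
    also have "{m. m < enumerate K k \<and> m \<in> K} = enumerate K ` {..<k}"
    proof (intro set_eqI iffI)
      fix m assume m: "m \<in> {m. m < enumerate K k \<and> m \<in> K}"
      then obtain j where j: "m = enumerate K j" using range_enumerate[OF K] by auto
      then have "j < k" using m strict_mono_less[OF strict_mono_enumerate[OF K]] by auto
      then show "m \<in> enumerate K ` {..<k}" using j by blast
    next
      fix m assume "m \<in> enumerate K ` {..<k}"
      then show "m \<in> {m. m < enumerate K k \<and> m \<in> K}"
        using strict_mono_less[OF strict_mono_enumerate[OF K]] range_enumerate[OF K] by auto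
    qed
    also have "card (enumerate K ` {..<k}) = k"
      using strict_mono_imp_inj_on[OF strict_mono_enumerate[OF K]]
      by (subst card_image) (auto intro: inj_on_subset)
    finally show "k \<in> i ` (E `` {x})" using y(1) by blast
  qed simp
  ultimately show ?thesis by blast
qed

text \<open>\<open>E\<close> is carried along \<open>e\<close> to a Borel relation on
  \<open>nat \<Rightarrow> real\<close> with countable sections, where \<open>Lusin_Novikov\<close>
  applies, and the functions found there are brought back by \<open>j\<close>.\<close>

lemma countable_borel_equiv_generated:
  assumes M: "standard_borel_space M" and ne: "space M \<noteq> {}" and CBE: "countable_borel_equiv M E"
  shows "\<exists>f :: nat \<Rightarrow> 'a \<Rightarrow> 'a. (\<forall>n. f n \<in> measurable M M) \<and> (\<forall>x \<in> space M. E `` {x} = range (\<lambda>n. f n x))"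
proof -
  have E: "equiv (space M) E" and E_sets[measurable]: "E \<in> sets (M \<Otimes>\<^sub>M M)"
    and cnt: "\<And>x. x \<in> space M \<Longrightarrow> countable (E `` {x})"
    using CBE by (auto simp: countable_borel_equiv_def quotientI)
  obtain e :: "'a \<Rightarrow> nat \<Rightarrow> real" where e[measurable]: "e \<in> borel_measurable M"
    and inj: "inj_on e (space M)" and im: "\<And>B. B \<in> sets M \<Longrightarrow> e ` B \<in> sets borel"
    using standard_borel_embedding[OF M ne] by blast
  obtain j where j[measurable]: "j \<in> measurable borel M" and j_e: "\<And>x. x \<in> space M \<Longrightarrow> j (e x) = x"
    using standard_borel_retraction[OF inj im ne] by blast
  have j_space: "j u \<in> space M" for u using measurable_space[OF j] by simp
  define G where "G = e ` space M"
  have G[measurable]: "G \<in> sets borel" using im[OF sets.top] by (simp add: G_def)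
  \<comment> \<open>The restriction to \<open>G\<close> keeps sections countable: \<open>j\<close>
    is injective on \<open>G\<close>, whereas its fibres off \<open>G\<close> are not
    controlled.\<close>
  define P where "P = {p. fst p \<in> G \<and> snd p \<in> G \<and> (j (fst p), j (snd p)) \<in> E}"
  have "{p \<in> space (borel \<Otimes>\<^sub>M borel). fst p \<in> G \<and> snd p \<in> G \<and> (j (fst p), j (snd p)) \<in> E} \<in> sets (borel \<Otimes>\<^sub>M borel)"
    by measurable
  then have "P \<in> sets borel" unfolding P_def borel_prod[symmetric] by (simp add: space_pair_measure)
  moreover have "countable {v. (u, v) \<in> P}" for u
  proof (rule countable_subset)
    show "{v. (u, v) \<in> P} \<subseteq> e ` (E `` {j u})"
    proof
      fix v assume "v \<in> {v. (u, v) \<in> P}"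
      then obtain y where y: "y \<in> space M" "v = e y" "(j u, j v) \<in> E" by (auto simp: P_def G_def)
      then have "y \<in> E `` {j u}" using j_e by auto
      then show "v \<in> e ` (E `` {j u})" using y(2) by blast
    qed
    show "countable (e ` (E `` {j u}))" using cnt[OF j_space] by (rule countable_image)
  qed
  ultimately have "\<exists>g :: nat \<Rightarrow> (nat \<Rightarrow> real) \<Rightarrow> nat \<Rightarrow> real. (\<forall>n. g n \<in> borel_measurable borel) \<and> (\<forall>(x, y) \<in> P. \<exists>n. y = g n x)"
    by (rule Lusin_Novikov)
  then obtain g :: "nat \<Rightarrow> (nat \<Rightarrow> real) \<Rightarrow> nat \<Rightarrow> real"
    where g: "\<forall>n. g n \<in> borel_measurable borel" "\<forall>(x, y) \<in> P. \<exists>n. y = g n x"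
    by (elim exE conjE)
  have [measurable]: "g n \<in> borel_measurable borel" for n using g(1) by simp
  \<comment> \<open>Where the candidate is not equivalent to \<open>x\<close> the value is
    \<open>x\<close> itself, so the functions enumerate the class and nothing else.\<close>
  define f where "f = (\<lambda>n x. if (x, j (g n (e x))) \<in> E then j (g n (e x)) else x)"
  have "f n \<in> measurable M M" for n unfolding f_def by measurable
  moreover have "E `` {x} = range (\<lambda>n. f n x)" if x: "x \<in> space M" for x
  proof (intro set_eqI iffI)
    fix y assume "y \<in> E `` {x}"
    then have xy: "(x, y) \<in> E" by simp
    then have y: "y \<in> space M" using E by (auto simp: equiv_def refl_on_def)
    have "(e x, e y) \<in> P" using x y xy j_e by (auto simp: P_def G_def)
    then obtain n where "e y = g n (e x)" using g(2) by blast
    then have "j (g n (e x)) = y" using j_e[OF y] by simp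
    then have "f n x = y" using xy by (simp add: f_def)
    then show "y \<in> range (\<lambda>n. f n x)" by blast
  next
    fix y assume "y \<in> range (\<lambda>n. f n x)"
    moreover have "(x, x) \<in> E" using E x by (auto simp: equiv_def refl_on_def)
    ultimately show "y \<in> E `` {x}" by (auto simp: f_def)
  qed
  ultimately show ?thesis by blast
qed

lemma aperiodic_surjection_on_classes:
  assumes M: "standard_borel_space M" and ne: "space M \<noteq> {}" and CBE: "countable_borel_equiv M E"
    and ap: "aperiodic_equiv M E"
  shows "\<exists>i \<in> measurable M (count_space (UNIV :: nat set)). \<forall>x \<in> space M. i ` (E `` {x}) = UNIV"
proof -
  obtain e :: "'a \<Rightarrow> nat \<Rightarrow> real" where e[measurable]: "e \<in> borel_measurable M" and inj: "inj_on e (space M)"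
    using standard_borel_embedding[OF M ne] by blast
  obtain f :: "nat \<Rightarrow> 'a \<Rightarrow> 'a" where f: "\<And>n. f n \<in> measurable M M"
    "\<And>x. x \<in> space M \<Longrightarrow> E `` {x} = range (\<lambda>n. f n x)"
    using countable_borel_equiv_generated[OF M ne CBE] by blast
  define V where "V = (\<lambda>k. {x \<in> space M. case from_nat k of (n::nat, q::rat) \<Rightarrow> e x n < of_rat q})"
  show ?thesis
  proof (rule measurable_surjection_on_classes[OF _ f])
    show "equiv (space M) E" using CBE by (simp add: countable_borel_equiv_def)
    show "infinite (E `` {x})" if "x \<in> space M" for x
      using ap that by (auto simp: aperiodic_equiv_def quotientI)
    show "V k \<in> sets M" for k
    proof (cases "from_nat k :: nat \<times> rat")
      case (Pair n q)
      have [measurable]: "(\<lambda>x. e x n) \<in> borel_measurable M"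
        using measurable_product_then_coordinatewise[OF e] .
      show ?thesis unfolding V_def Pair by simp
    qed
    show "x = y" if "x \<in> space M" "y \<in> space M" "\<And>k. x \<in> V k \<longleftrightarrow> y \<in> V k" for x y
    proof -
      have "(\<lambda>k. case from_nat k of (n::nat, q::rat) \<Rightarrow> e x n < of_rat q) =
          (\<lambda>k. case from_nat k of (n, q) \<Rightarrow> e y n < of_rat q)"
        using that by (auto simp: V_def)
      then have "e x = e y" by (rule injD[OF rational_cuts_injective])
      then show ?thesis using inj that by (auto dest: inj_onD)
    qed
  qed
qed

section \<open>Lusin marker schemes\<close>

text \<open>Baire space is realised as the set of \<open>\<nat>\<close>-valued sequences in \<^typ>\<open>nat \<Rightarrow> real\<close>.\<close>

definition nat_cylinder :: "nat list \<Rightarrow> (nat \<Rightarrow> real) set" where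
  "nat_cylinder s = {z. (\<forall>k. z k \<in> \<nat>) \<and> (\<forall>k<length s. z k = real (s ! k))}"

text \<open>These sets are pairwise disjoint because \<open>length s\<close> is the last position carrying the value 2.\<close>

definition nat_cylinder_tail :: "nat list \<Rightarrow> (nat \<Rightarrow> real) set" where
  "nat_cylinder_tail s = {z \<in> nat_cylinder s. z (length s) = 2 \<and> (\<forall>k>length s. z k \<in> {0, 1})}"

lemma nat_cylinder_borel [measurable]: "nat_cylinder s \<in> sets borel"
proof -
  have [measurable]: "(\<nat> :: real set) \<in> sets borel" by (simp add: closed_Nats)
  have "{z \<in> space (borel :: (nat \<Rightarrow> real) measure). (\<forall>k. z k \<in> \<nat>) \<and> (\<forall>k<length s. z k = real (s ! k))} \<in> sets borel"
    by measurable
  then show ?thesis by (simp add: nat_cylinder_def)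
qed

lemma nat_cylinder_tail_borel [measurable]: "nat_cylinder_tail s \<in> sets borel"
proof -
  have "{z \<in> space (borel :: (nat \<Rightarrow> real) measure). z \<in> nat_cylinder s \<and> z (length s) = 2 \<and> (\<forall>k>length s. z k \<in> {0, 1})} \<in> sets borel"
    by measurable
  then show ?thesis by (simp add: nat_cylinder_tail_def)
qed

lemma nat_cylinder_tail_disjoint:
  assumes "z \<in> nat_cylinder_tail s" "z \<in> nat_cylinder_tail t"
  shows "s = t"
proof -
  have "length s = length t"
    using assms by (cases "length s" "length t" rule: linorder_cases) (auto simp: nat_cylinder_tail_def)
  then show ?thesis
    using assms by (intro nth_equalityI) (auto simp: nat_cylinder_tail_def nat_cylinder_def)
qed

lemma uncountable_nat_cylinder_tail: "uncountable (nat_cylinder_tail s)"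
proof
  assume c: "countable (nat_cylinder_tail s)"
  define \<zeta> where "\<zeta> = (\<lambda>(\<alpha> :: nat \<Rightarrow> bool) k. if k < length s then real (s ! k)
    else if k = length s then 2 else of_bool (\<alpha> (k - Suc (length s))))"
  have "\<zeta> \<alpha> \<in> nat_cylinder_tail s" for \<alpha>
    by (auto simp: \<zeta>_def nat_cylinder_tail_def nat_cylinder_def of_bool_def)
  then have "countable (range \<zeta>)" using c by (meson countable_subset image_subsetI)
  moreover have "inj \<zeta>"
  proof (rule injI, rule ext)
    fix \<alpha> \<beta> k assume "\<zeta> \<alpha> = \<zeta> \<beta>"
    from fun_cong[OF this, of "k + Suc (length s)"] show "\<alpha> k = \<beta> k"
      by (simp add: \<zeta>_def of_bool_def split: if_splits)
  qed
  ultimately show False using countable_image_inj_on uncountable_UNIV_nat_bool by blast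
qed

text \<open>The empty sequence also takes everything left over by the tails; its cylinder is the
  whole Baire space, so the parts become a partition with each part still inside its own
  cylinder.\<close>

definition nat_cylinder_part :: "nat list \<Rightarrow> (nat \<Rightarrow> real) set" where
  "nat_cylinder_part s = (if s = [] then nat_cylinder [] - (\<Union>t \<in> - {[]}. nat_cylinder_tail t) else nat_cylinder_tail s)"

lemma nat_cylinder_part_borel: "nat_cylinder_part s \<in> sets borel"
proof -
  have "(\<Union>t \<in> - {[]}. nat_cylinder_tail t) \<in> sets borel" by (rule sets.countable_UN'') auto
  then show ?thesis by (auto simp: nat_cylinder_part_def)
qed

lemma uncountable_nat_cylinder_part: "uncountable (nat_cylinder_part s)"
proof -
  have "nat_cylinder_tail s \<subseteq> nat_cylinder_part s"
    using nat_cylinder_tail_disjoint by (fastforce simp: nat_cylinder_part_def nat_cylinder_tail_def[of "[]"])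
  then show ?thesis using uncountable_nat_cylinder_tail countable_subset by blast
qed

lemma nat_cylinder_part_subset: "nat_cylinder_part s \<subseteq> nat_cylinder s"
  by (auto simp: nat_cylinder_part_def nat_cylinder_tail_def)

lemma nat_cylinder_part_disjoint:
  "z \<in> nat_cylinder_part s \<Longrightarrow> z \<in> nat_cylinder_part t \<Longrightarrow> s = t"
  using nat_cylinder_tail_disjoint by (auto simp: nat_cylinder_part_def split: if_splits)

lemma UN_nat_cylinder_part: "(\<Union>s. nat_cylinder_part s) = nat_cylinder []"
proof
  have "nat_cylinder s \<subseteq> nat_cylinder []" for s by (auto simp: nat_cylinder_def)
  then show "(\<Union>s. nat_cylinder_part s) \<subseteq> nat_cylinder []" using nat_cylinder_part_subset by blast
  show "nat_cylinder [] \<subseteq> (\<Union>s. nat_cylinder_part s)"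
  proof
    fix z assume z: "z \<in> nat_cylinder []"
    show "z \<in> (\<Union>s. nat_cylinder_part s)"
    proof (cases "\<exists>t. t \<noteq> [] \<and> z \<in> nat_cylinder_tail t")
      case True
      then obtain t where "t \<noteq> []" "z \<in> nat_cylinder_tail t" by blast
      then have "z \<in> nat_cylinder_part t" by (simp add: nat_cylinder_part_def)
      then show ?thesis by blast
    next
      case False
      then have "z \<in> nat_cylinder_part []" using z by (auto simp: nat_cylinder_part_def)
      then show ?thesis by blast
    qed
  qed
qed

section \<open>The schemes of type I and type II\<close>

lemma nat_cylinder_append: "z \<in> nat_cylinder (s @ [n]) \<longleftrightarrow> z \<in> nat_cylinder s \<and> z (length s) = real n"
  by (auto simp: nat_cylinder_def nth_append less_Suc_eq)

text \<open>The map \<phi> is glued from Borel isomorphisms of the fibres of \<open>i\<close> with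
  the parts, and \<open>A s\<close> is the preimage of the cylinder of \<open>s\<close>. Every class
  contains a point with code \<open>s\<close>, which \<phi> sends into that cylinder; bijectivity of
  \<phi> makes branches singletons.\<close>

lemma type_I_scheme_exists:
  assumes M: "standard_borel_space M" and unc: "uncountable (space M)" and CBE: "countable_borel_equiv M E"
    and i: "i \<in> measurable M (count_space (UNIV :: nat set))"
    and surj: "\<And>x. x \<in> space M \<Longrightarrow> i ` (E `` {x}) = UNIV"
  shows "\<exists>A. lusin_marker_scheme_type_I M E A"
proof -
  have E: "equiv (space M) E" and cnt: "\<And>x. x \<in> space M \<Longrightarrow> countable (E `` {x})"
    using CBE by (auto simp: countable_borel_equiv_def quotientI)
  have E_space: "y \<in> space M" if "y \<in> E `` {x}" for x y
    using that E by (auto simp: equiv_def refl_on_def)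
  have ne: "space M \<noteq> {}" using unc by auto
  obtain e :: "'a \<Rightarrow> nat \<Rightarrow> real" where e[measurable]: "e \<in> borel_measurable M"
    and inj: "inj_on e (space M)" and im: "\<And>B. B \<in> sets M \<Longrightarrow> e ` B \<in> sets borel"
    using standard_borel_embedding[OF M ne] by blast
  define X where "X = (\<lambda>m. {x \<in> space M. i x = m})"
  have X: "X m \<in> sets M" for m
    using measurable_sets[OF i, of "{m}"] by (simp add: X_def vimage_def Int_def conj_commute)
  have X_unc: "uncountable (X m)" for m
  proof
    assume c: "countable (X m)"
    \<comment> \<open>Each fibre meets every class, so its saturation is the whole space; a
      countable fibre with countable classes would make the space countable.\<close>
    have "space M \<subseteq> (\<Union>y \<in> X m. E `` {y})"
    proof
      fix x assume x: "x \<in> space M"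
      then obtain y where y: "y \<in> E `` {x}" "i y = m" using surj[OF x] by (metis UNIV_I imageE)
      then have "y \<in> X m" "x \<in> E `` {y}" using E_space E by (auto simp: X_def equiv_def sym_def)
      then show "x \<in> (\<Union>y \<in> X m. E `` {y})" by blast
    qed
    moreover have "countable (\<Union>y \<in> X m. E `` {y})" using c cnt by (auto simp: X_def)
    ultimately show False using unc countable_subset by blast
  qed
  have eX_unc: "uncountable (e ` X m)" for m
    using X_unc[of m] countable_image_inj_on[of e "X m"] inj_on_subset[OF inj] by (auto simp: X_def)
  have "\<forall>m. \<exists>h. bij_betw h (e ` X m) (nat_cylinder_part (list_decode m)) \<and>
      (\<forall>D \<in> sets borel. {x \<in> e ` X m. h x \<in> D} \<in> sets borel)"
    using borel_isomorphism[OF im[OF X] eX_unc nat_cylinder_part_borel uncountable_nat_cylinder_part] by blast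
  from choice[OF this] obtain h where h: "\<And>m. bij_betw (h m) (e ` X m) (nat_cylinder_part (list_decode m))"
    "\<And>m D. D \<in> sets borel \<Longrightarrow> {x \<in> e ` X m. h m x \<in> D} \<in> sets borel" by blast
  define \<phi> where "\<phi> = (\<lambda>x. h (i x) (e x))"
  have \<phi>_part: "\<phi> x \<in> nat_cylinder_part (list_decode (i x))" if "x \<in> space M" for x
  proof -
    have "e x \<in> e ` X (i x)" using that by (auto simp: X_def)
    then show ?thesis using bij_betw_apply[OF h(1)[of "i x"]] by (simp add: \<phi>_def)
  qed
  have \<phi>_inj: "x = y" if "x \<in> space M" "y \<in> space M" "\<phi> x = \<phi> y" for x y
  proof -
    have "list_decode (i x) = list_decode (i y)"
      using nat_cylinder_part_disjoint \<phi>_part that by metis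
    then have "i x = i y" by (metis list_decode_inverse)
    moreover have "e x \<in> e ` X (i x)" "e y \<in> e ` X (i y)" using that by (auto simp: X_def)
    ultimately have "e x = e y"
      using that(3) bij_betw_imp_inj_on[OF h(1)[of "i x"]] by (auto simp: \<phi>_def dest: inj_onD)
    then show ?thesis using inj that by (auto dest: inj_onD)
  qed
  have \<phi>_surj: "\<exists>x \<in> space M. \<phi> x = z" if z: "z \<in> nat_cylinder []" for z
  proof -
    obtain s where "z \<in> nat_cylinder_part s" using z UN_nat_cylinder_part by blast
    then have "z \<in> nat_cylinder_part (list_decode (list_encode s))" by simp
    then obtain x where "x \<in> X (list_encode s)" "z = h (list_encode s) (e x)"
      using bij_betw_imp_surj_on[OF h(1)[of "list_encode s"]] by blast
    then show ?thesis by (intro bexI[of _ x]) (auto simp: X_def \<phi>_def)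
  qed
  have \<phi>_base: "\<phi> x \<in> nat_cylinder []" if "x \<in> space M" for x
    using \<phi>_part[OF that] UN_nat_cylinder_part by blast
  define A where "A = (\<lambda>s. {x \<in> space M. \<phi> x \<in> nat_cylinder s})"
  have A_sets: "A s \<in> sets M" for s
  proof -
    \<comment> \<open>\<phi> is measurable only piecewise, so the preimage is taken on each of the
      countably many fibres of \<open>i\<close> separately.\<close>
    define D where "D = (\<lambda>m. {u \<in> e ` X m. h m u \<in> nat_cylinder s})"
    have "A s = (\<Union>m. X m \<inter> (e -` D m \<inter> space M))"
      by (auto simp: A_def D_def X_def \<phi>_def)
    moreover have "e -` D m \<inter> space M \<in> sets M" for m
      unfolding D_def by (rule measurable_sets[OF e h(2)]) measurable
    ultimately show ?thesis using X by auto
  qed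
  moreover have A_nil: "A [] = space M" using \<phi>_base by (auto simp: A_def)
  moreover have A_append: "x \<in> A (s @ [n]) \<longleftrightarrow> x \<in> A s \<and> \<phi> x (length s) = real n" for x s n
    by (auto simp: A_def nat_cylinder_append)
  then have "disjoint_family (\<lambda>n. A (s @ [n]))" for s
    by (auto simp: disjoint_family_on_def)
  moreover have A_UN: "(\<Union>n. A (s @ [n])) = A s" for s
  proof (intro set_eqI iffI)
    fix x assume x: "x \<in> A s"
    then have "\<phi> x (length s) \<in> \<nat>" by (auto simp: A_def nat_cylinder_def)
    then obtain n where "\<phi> x (length s) = real n" by (auto elim: Nats_cases)
    then show "x \<in> (\<Union>n. A (s @ [n]))" using x A_append by blast
  qed (use A_append in blast)
  moreover have "complete_section M E (A s)" for s
    unfolding complete_section_def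
  proof (intro conjI ballI)
    show "A s \<subseteq> space M" by (auto simp: A_def)
    fix C assume "C \<in> space M // E"
    then obtain x where x: "x \<in> space M" "C = E `` {x}" by (auto elim: quotientE)
    then obtain y where y: "y \<in> E `` {x}" "i y = list_encode s" using surj[OF x(1)] by (metis UNIV_I imageE)
    then have "\<phi> y \<in> nat_cylinder_part s" using \<phi>_part[OF E_space[OF y(1)]] by simp
    then have "y \<in> A s" using nat_cylinder_part_subset E_space[OF y(1)] by (auto simp: A_def)
    then show "A s \<inter> C \<noteq> {}" using y(1) x(2) by blast
  qed
  ultimately have "lusin_marker_scheme M E A" by (simp add: lusin_marker_scheme_def)
  moreover have "is_singleton (\<Inter>n. A (map \<sigma> [0..<n]))" for \<sigma> :: "nat \<Rightarrow> nat"
  proof -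
    define z where "z = (\<lambda>k. real (\<sigma> k))"
    have "z \<in> nat_cylinder []" by (simp add: z_def nat_cylinder_def)
    then obtain x where x: "x \<in> space M" "\<phi> x = z" using \<phi>_surj by blast
    have "(\<Inter>n. A (map \<sigma> [0..<n])) = {x}"
    proof (intro set_eqI iffI)
      fix y assume y: "y \<in> (\<Inter>n. A (map \<sigma> [0..<n]))"
      have "\<phi> y k = z k" for k
      proof -
        have "y \<in> A (map \<sigma> [0..<Suc k])" using y by blast
        then show ?thesis by (simp add: A_append z_def)
      qed
      then have "\<phi> y = \<phi> x" using x(2) by auto
      moreover have "y \<in> space M" using y by (auto simp: A_def)
      ultimately show "y \<in> {x}" using \<phi>_inj x(1) by auto
    next
      fix y assume "y \<in> {x}"
      then show "y \<in> (\<Inter>n. A (map \<sigma> [0..<n]))"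
        using x by (auto simp: A_def nat_cylinder_def z_def)
    qed
    then show ?thesis by (simp add: is_singleton_def)
  qed
  ultimately show ?thesis
    using A_UN unfolding lusin_marker_scheme_type_I_def by blast
qed

lemma type_II_scheme_exists:
  assumes i: "i \<in> measurable M (count_space (UNIV :: nat set))" and E: "equiv (space M) E"
    and surj: "\<And>x. x \<in> space M \<Longrightarrow> i ` (E `` {x}) = UNIV"
  shows "\<exists>A. lusin_marker_scheme_type_II M E A"
proof -
  have E_space: "y \<in> space M" if "y \<in> E `` {x}" for x y
    using that E by (auto simp: equiv_def refl_on_def)
  have sets: "{x \<in> space M. Q (list_decode (i x))} \<in> sets M" for Q
    using measurable_sets[OF i, of "{m. Q (list_decode m)}"] by (simp add: vimage_def Int_def conj_commute)
  have is_section: "complete_section M E {x \<in> space M. Q (list_decode (i x))}" if "Q s" for Q s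
    unfolding complete_section_def
  proof (intro conjI ballI)
    fix C assume "C \<in> space M // E"
    then obtain x where x: "x \<in> space M" "C = E `` {x}" by (auto elim: quotientE)
    then obtain y where y: "y \<in> E `` {x}" "i y = list_encode s" using surj[OF x(1)] by (metis UNIV_I imageE)
    then have "y \<in> {x \<in> space M. Q (list_decode (i x))} \<inter> C"
      using E_space[OF y(1)] that x(2) by simp
    then show "{x \<in> space M. Q (list_decode (i x))} \<inter> C \<noteq> {}" by blast
  qed blast
  \<comment> \<open>\<open>s\<close> is required to be a prefix of the code; a code shorter than
    \<open>s\<close> cannot satisfy the equation. Level \<open>n\<close> thus consists of the points
    with code length at least \<open>n\<close>, and since codes are finite the levels
    vanish.\<close>
  define A where "A = (\<lambda>s. {x \<in> space M. take (length s) (list_decode (i x)) = s})"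
  have "lusin_marker_scheme M E A"
    unfolding lusin_marker_scheme_def
  proof (intro conjI allI)
    fix s
    show "A s \<in> sets M" unfolding A_def by (rule sets)
    show "complete_section M E (A s)" unfolding A_def by (rule is_section[of _ s]) simp
    show "disjoint_family (\<lambda>n. A (s @ [n]))"
      by (auto simp: A_def disjoint_family_on_def)
    show "(\<Union>n. A (s @ [n])) \<subseteq> A s"
    proof
      fix x assume "x \<in> (\<Union>n. A (s @ [n]))"
      then obtain n where n: "x \<in> space M" "take (Suc (length s)) (list_decode (i x)) = s @ [n]"
        by (auto simp: A_def)
      have "take (length s) (list_decode (i x)) = take (length s) (take (Suc (length s)) (list_decode (i x)))"
        by simp
      also have "\<dots> = s" unfolding n(2) by simp
      finally show "x \<in> A s" using n(1) by (simp add: A_def)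
    qed
  qed (auto simp: A_def)
  moreover have B: "(\<Union>s \<in> {s. length s = n}. A s) = {x \<in> space M. n \<le> length (list_decode (i x))}" for n
  proof (intro set_eqI iffI)
    fix x assume "x \<in> (\<Union>s \<in> {s. length s = n}. A s)"
    then have "x \<in> space M" "min (length (list_decode (i x))) n = n" by (auto simp: A_def)
    then show "x \<in> {x \<in> space M. n \<le> length (list_decode (i x))}" by simp
  next
    fix x assume "x \<in> {x \<in> space M. n \<le> length (list_decode (i x))}"
    then show "x \<in> (\<Union>s \<in> {s. length s = n}. A s)"
      by (intro UN_I[of "take n (list_decode (i x))"]) (auto simp: A_def)
  qed
  have "vanishing_marker_sequence M E (\<lambda>n. \<Union>s \<in> {s. length s = n}. A s)"
    unfolding vanishing_marker_sequence_def B
  proof (intro conjI allI)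
    show "decseq (\<lambda>n. {x \<in> space M. n \<le> length (list_decode (i x))})" by (auto simp: decseq_def)
    show "{x \<in> space M. n \<le> length (list_decode (i x))} \<in> sets M" for n by (rule sets)
    show "complete_section M E {x \<in> space M. n \<le> length (list_decode (i x))}" for n
      \<comment> \<open>Any sequence of length \<open>n\<close> would serve as a code that every
        class must contain.\<close>
      by (rule is_section[of _ "replicate n 0"]) simp
    show "(\<Inter>n. {x \<in> space M. n \<le> length (list_decode (i x))}) = {}"
      using not_less_eq_eq by blast
  qed
  ultimately show ?thesis unfolding lusin_marker_scheme_type_II_def by blast
qed

theorem theorem3p3:
  fixes M :: "'a measure" and E :: "('a \<times> 'a) set"
  assumes "standard_borel_space M"
    and "uncountable (space M)"
    and "countable_borel_equiv M E"
    and "aperiodic_equiv M E"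
  shows "(\<exists>A. lusin_marker_scheme_type_I M E A) \<and> (\<exists>A. lusin_marker_scheme_type_II M E A)"
proof -
  have "space M \<noteq> {}" using assms(2) by auto
  then obtain i where i: "i \<in> measurable M (count_space (UNIV :: nat set))"
    "\<And>x. x \<in> space M \<Longrightarrow> i ` (E `` {x}) = UNIV"
    using aperiodic_surjection_on_classes[OF assms(1) _ assms(3,4)] by blast
  moreover have "equiv (space M) E" using assms(3) by (simp add: countable_borel_equiv_def)
  ultimately show ?thesis
    using type_I_scheme_exists[OF assms(1-3) i] type_II_scheme_exists[OF i(1) _ i(2)] by blast
qed

end
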